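(* Let $\sigma$ be a self-adjoint operator mean with representing function $f$, and let $g$ be a real-valued function on $(0,\infty)$. (a) If $\sqrt{\cdot}\prec_{sa} f$ and $g(A\#B)\le g(A\sigma B)$ for all positive definite $A,B$ such that $A<B$, then $g$ is operator monotone on $(0,\infty)$. (b) If $\sqrt{\cdot}\prec_{sa} f^{\dagger}$, where $f^\dagger(t)=t/f(t)$, and $g(A\#B)\ge g(A\sigma B)$ for all positive definite $A,B$ such that $A<B$, then $g$ is operator monotone on $(0,\infty)$.
   Context: Positive operators are taken to be positive definite complex $n\times n$ matrices, $n$ arbitrary; $\le$ is the Loewner order, $A<B$ means $B-A$ is positive definite, and functions of Hermitian matrices are defined by functional calculus. A real function $g$ on $(0,\infty)$ is operator monotone if for every $n$ and all positive definite $n\times n$ matrices $X\le Y$ one has $g(X)\le g(Y)$. An operator mean $\sigma$ (Kubo-Ando mean) is given by its representing function $f:(0,\infty)\to(0,\infty)$, operator monotone with $f(1)=1$, via $A\sigma B=A^{1/2}f(A^{-1/2}BA^{-1/2})A^{1/2}$. The geometric mean $\#$ has representing function $\sqrt t$. The mean $\sigma$ is self-adjoint if $(A\sigma B)^{-1}=A^{-1}\sigma B^{-1}$ for all positive definite $A,B$; equivalently $f\in\mathcal E$, where $\mathcal E$ is the set of operator monotone functions $f:(0,\infty)\to(0,\infty)$ with $f(t^{-1})=f(t)^{-1}$ for all $t>0$. By a known theorem of Hansen, the functions $f\in\mathcal E$ are exactly those of the form $$f(t)=\exp\int_{-1}^0\left(\frac1{\lambda-t}+\frac{t}{1-\lambda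 t}\right)h_f(\lambda)\,d\lambda$$ with $h_f:[-1,0]\to[0,1]$ measurable, and $h_f$ is determined uniquely a.e. by $f$. For $f,g\in\mathcal E$, $g\preceq_{sa}f$ (also written $f\succeq_{sa}g$) means that $f/g$ is operator monotone; $g\prec_{sa}f$ means that $g\preceq_{sa}f$ and $h_f\ne h_g$ on a set of non-zero measure (equivalently, $g\preceq_{sa} f$ and $f\neq g$). *)

theory Defs
  imports
    "HOL-Analysis.Analysis"
    "Jordan_Normal_Form.Schur_Decomposition"
    "Jordan_Normal_Form.Gauss_Jordan_Elimination"
begin

definition hermitian_mat :: "nat \<Rightarrow> complex mat \<Rightarrow> bool" where
  "hermitian_mat n A \<longleftrightarrow> A \<in> carrier_mat n n \<and> mat_adjoint A = A"

text \<open>The form \<open>(A *\<^sub>v v) \<bullet>c v\<close> is $v^* A v$; it is real for Hermitian \<open>A\<close>.\<close>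

definition psd_mat :: "nat \<Rightarrow> complex mat \<Rightarrow> bool" where
  "psd_mat n A \<longleftrightarrow> hermitian_mat n A \<and>
     (\<forall>v \<in> carrier_vec n. 0 \<le> Re ((A *\<^sub>v v) \<bullet>c v))"

definition pd_mat :: "nat \<Rightarrow> complex mat \<Rightarrow> bool" where
  "pd_mat n A \<longleftrightarrow> hermitian_mat n A \<and>
     (\<forall>v \<in> carrier_vec n. v \<noteq> 0\<^sub>v n \<longrightarrow> 0 < Re ((A *\<^sub>v v) \<bullet>c v))"

definition loewner_le :: "nat \<Rightarrow> complex mat \<Rightarrow> complex mat \<Rightarrow> bool" where
  "loewner_le n X Y \<longleftrightarrow>
     X \<in> carrier_mat n n \<and> Y \<in> carrier_mat n n \<and> psd_mat n (Y - X)"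

definition loewner_less :: "nat \<Rightarrow> complex mat \<Rightarrow> complex mat \<Rightarrow> bool" where
  "loewner_less n X Y \<longleftrightarrow>
     X \<in> carrier_mat n n \<and> Y \<in> carrier_mat n n \<and> pd_mat n (Y - X)"

text \<open>Functional calculus: if $A = U\,\mathrm{diag}(d)\,U^*$ with \<open>U\<close> unitary and \<open>d\<close> real, then
  $f(A) = U\,\mathrm{diag}(f \circ d)\,U^*$. For Hermitian \<open>A\<close> this matrix exists and does not
  depend on the choice of \<open>U\<close> and \<open>d\<close>. It only involves the values of \<open>f\<close> on the spectrum of \<open>A\<close>.\<close>

definition mat_fun :: "(real \<Rightarrow> real) \<Rightarrow> complex mat \<Rightarrow> complex mat" where
  "mat_fun f A = (THE B. \<exists>U (d :: nat \<Rightarrow> real). let n = dim_row A in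
     U \<in> carrier_mat n n \<and> mat_adjoint U * U = 1\<^sub>m n \<and>
     A = U * mat_diag n (\<lambda>i. complex_of_real (d i)) * mat_adjoint U \<and>
     B = U * mat_diag n (\<lambda>i. complex_of_real (f (d i))) * mat_adjoint U)"

abbreviation mat_inv :: "complex mat \<Rightarrow> complex mat" where
  "mat_inv A \<equiv> the (mat_inverse A)"

text \<open>Functions on $(0,\infty)$ are total functions on the reals whose values at
  nonpositive arguments play no role.\<close>

definition operator_monotone :: "(real \<Rightarrow> real) \<Rightarrow> bool" where
  "operator_monotone g \<longleftrightarrow>
     (\<forall>n X Y. pd_mat n X \<and> pd_mat n Y \<and> loewner_le n X Y \<longrightarrow>
        loewner_le n (mat_fun g X) (mat_fun g Y))"

definition op_mean :: "(real \<Rightarrow> real) \<Rightarrow> complex mat \<Rightarrow> complex mat \<Rightarrow> complex mat" where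
  "op_mean f A B =
     (let R = mat_fun sqrt A; S = mat_fun (\<lambda>t. 1 / sqrt t) A
      in R * mat_fun f (S * B * S) * R)"

abbreviation geometric_mean :: "complex mat \<Rightarrow> complex mat \<Rightarrow> complex mat" where
  "geometric_mean \<equiv> op_mean sqrt"

definition operator_mean ::
  "(complex mat \<Rightarrow> complex mat \<Rightarrow> complex mat) \<Rightarrow> (real \<Rightarrow> real) \<Rightarrow> bool" where
  "operator_mean \<sigma> f \<longleftrightarrow>
     (\<forall>t>0. 0 < f t) \<and> operator_monotone f \<and> f 1 = 1 \<and>
     (\<forall>n A B. pd_mat n A \<and> pd_mat n B \<longrightarrow> \<sigma> A B = op_mean f A B)"

definition self_adjoint_mean :: "(complex mat \<Rightarrow> complex mat \<Rightarrow> complex mat) \<Rightarrow> bool" where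
  "self_adjoint_mean \<sigma> \<longleftrightarrow>
     (\<forall>n A B. pd_mat n A \<and> pd_mat n B \<longrightarrow>
        mat_inv (\<sigma> A B) = \<sigma> (mat_inv A) (mat_inv B))"

definition hansen_rep :: "(real \<Rightarrow> real) \<Rightarrow> (real \<Rightarrow> real) \<Rightarrow> bool" where
  "hansen_rep f h \<longleftrightarrow>
     h \<in> borel_measurable (lebesgue_on {-1..0}) \<and> (\<forall>l \<in> {-1..0}. h l \<in> {0..1}) \<and>
     (\<forall>t>0. f t = exp (LINT l|lebesgue_on {-1..0}. (1 / (l - t) + t / (1 - l * t)) * h l))"

text \<open>By Hansen's theorem such a density exists for every operator monotone
  \<open>f : (0,\<infinity>) \<rightarrow> (0,\<infinity>)\<close> with \<open>f (1/t) = 1 / f t\<close>, and it is unique almost everywhere, so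
  null sets of the chosen densities do not depend on the choice.\<close>

definition hansen_density :: "(real \<Rightarrow> real) \<Rightarrow> real \<Rightarrow> real" where
  "hansen_density f = (SOME h. hansen_rep f h)"

text \<open>\<open>sa_le g f\<close> and \<open>sa_less g f\<close> are $g \preceq_{sa} f$ and $g \prec_{sa} f$; they are meant for
  \<open>f\<close> and \<open>g\<close> in the class of the previous paragraph.\<close>

definition sa_le :: "(real \<Rightarrow> real) \<Rightarrow> (real \<Rightarrow> real) \<Rightarrow> bool" where
  "sa_le g f \<longleftrightarrow> operator_monotone (\<lambda>t. f t / g t)"

definition sa_less :: "(real \<Rightarrow> real) \<Rightarrow> (real \<Rightarrow> real) \<Rightarrow> bool" where
  "sa_less g f \<longleftrightarrow> sa_le g f \<and>
     emeasure lebesgue {l \<in> {-1..0}. hansen_density f l \<noteq> hansen_density g l} \<noteq> 0"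

end

theory Submission
  imports Defs "Jordan_Normal_Form.Spectral_Radius"
begin

text \<open>Congruence of both arguments acts on an operator mean entrywise: for invertible \<open>T\<close>,
  the mean of $T\,\mathrm{diag}(a)\,T^*$ and $T\,\mathrm{diag}(b)\,T^*$ is
  $T\,\mathrm{diag}(a_i f(b_i/a_i))\,T^*$. Given positive definite $X<Y$, simultaneous diagonalisation
  reduces the equations $A \# B = X$, $A \sigma B = Y$ to scalar ones, which with $a = x/c$,
  $b = xc$ become $\varphi(c^2) = y/x$ for $\varphi(t) = f(t)/\sqrt t$. Since $\varphi$ is operator
  monotone, hence continuous, and nonconstant with $\varphi(1/t) = 1/\varphi(t)$, they are solvable with
  $c>1$ as soon as $1 < y/x \le M$ for some $M>1$. Inserting geometric means between $x$ and $y$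
  gives $g(X) \le g(Y)$ whenever $X<Y$; this already forces $g$ to be continuous, and letting
  $\varepsilon \to 0$ in $g(X) \le g(Y+\varepsilon)$ settles the case $X \le Y$. Part (b) is the same with
  $a = y/c$, $b = yc$ and $t/f(t)$ in place of $f(t)$.\<close>

section \<open>Adjoints and the spectral theorem\<close>

lemma mat_adjoint_carrier [simp]:
  "A \<in> carrier_mat nr nc \<Longrightarrow> mat_adjoint A \<in> carrier_mat nc nr"
  unfolding mat_adjoint_def by auto

lemma mat_adjoint_dim [simp]:
  "dim_row (mat_adjoint A) = dim_col A" "dim_col (mat_adjoint A) = dim_row A"
  unfolding mat_adjoint_def by auto

lemma mat_adjoint_index [simp]:
  "i < dim_col A \<Longrightarrow> j < dim_row A \<Longrightarrow> mat_adjoint A $$ (i, j) = conjugate (A $$ (j, i))"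
  unfolding mat_adjoint_def by (simp add: mat_of_rows_index)

lemma mat_mult_index:
  "i < dim_row A \<Longrightarrow> j < dim_col B \<Longrightarrow> dim_col A = n \<Longrightarrow> dim_row B = n \<Longrightarrow>
   (A * B) $$ (i, j) = (\<Sum>k<n. A $$ (i, k) * B $$ (k, j))"
  by (simp add: scalar_prod_def lessThan_atLeast0)

lemma mat_adjoint_mult:
  fixes A B :: "complex mat"
  assumes "A \<in> carrier_mat n m" "B \<in> carrier_mat m l"
  shows "mat_adjoint (A * B) = mat_adjoint B * mat_adjoint A"
  using assms
  by (intro eq_matI) (auto simp: mat_mult_index[where n=m] mult.commute simp del: index_mult_mat(1))

lemma mat_adjoint_adjoint [simp]: "mat_adjoint (mat_adjoint A) = A"
  by (rule eq_matI) auto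

lemma mat_adjoint_one [simp]: "mat_adjoint (1\<^sub>m n :: complex mat) = 1\<^sub>m n"
  by (rule eq_matI) auto

lemma assoc_mult_mat_square:
  fixes A B C :: "complex mat"
  shows
  "A \<in> carrier_mat n n \<Longrightarrow> B \<in> carrier_mat n n \<Longrightarrow> C \<in> carrier_mat n n \<Longrightarrow> A * B * C = A * (B * C)"
  by (rule assoc_mult_mat)

text \<open>Products are reassociated to the right throughout; in this form an adjacent inverse pair
  can be removed in front of any remaining factor \<open>X\<close>.\<close>

lemma mult_cancel_inverse:
  fixes A B X :: "complex mat"
  assumes "A \<in> carrier_mat n n" "B \<in> carrier_mat n n" "A * B = 1\<^sub>m n" "X \<in> carrier_mat n n"
  shows "A * (B * X) = X"
  using assms by (simp add: assoc_mult_mat[symmetric, of A n n B n X n] left_mult_one_mat[of X n n])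

lemma conjugation_cancel:
  fixes A V W :: "complex mat"
  assumes "A \<in> carrier_mat n n" "V \<in> carrier_mat n n" "W \<in> carrier_mat n n" "V * W = 1\<^sub>m n"
  shows "V * (W * A * V) * W = A"
proof -
  have "V * (W * A * V) * W = V * (W * (A * (V * W)))"
    using assms(1-3) by (simp add: assoc_mult_mat_square[of _ n] mult_carrier_mat[of _ n n])
  then show ?thesis
    using assms by (simp add: mult_cancel_inverse)
qed

text \<open>Congruence of a real diagonal matrix. Unitary \<open>T\<close> gives a spectral
  decomposition, invertible \<open>T\<close> the simultaneous diagonalisation of a pair.\<close>

definition cdiag :: "nat \<Rightarrow> complex mat \<Rightarrow> (nat \<Rightarrow> real) \<Rightarrow> complex mat" where
  "cdiag n T d = T * mat_diag n (\<lambda>i. complex_of_real (d i)) * mat_adjoint T"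

lemma cdiag_carrier [simp]: "T \<in> carrier_mat m n \<Longrightarrow> cdiag n T d \<in> carrier_mat m m"
  unfolding cdiag_def by (auto intro!: mult_carrier_mat[of _ _ n])

lemma cdiag_dim [simp]: "dim_row (cdiag n T d) = dim_row T" "dim_col (cdiag n T d) = dim_row T"
  unfolding cdiag_def by auto

lemma cdiag_index:
  assumes "T \<in> carrier_mat m n" "i < m" "j < m"
  shows "cdiag n T d $$ (i, j) = (\<Sum>k<n. of_real (d k) * T $$ (i, k) * cnj (T $$ (j, k)))"
  using assms unfolding cdiag_def
  by (subst mat_mult_index[where n=n])
     (auto simp: mat_diag_mult_right[of _ m] algebra_simps intro!: sum.cong)

lemma cdiag_hermitian [simp]: "T \<in> carrier_mat n n \<Longrightarrow> hermitian_mat n (cdiag n T d)"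
  unfolding hermitian_mat_def
  by (auto intro!: eq_matI simp: cdiag_index[of _ n n] algebra_simps)

lemma cdiag_minus:
  assumes "T \<in> carrier_mat n n"
  shows "cdiag n T y - cdiag n T x = cdiag n T (\<lambda>i. y i - x i)"
  using assms
  by (intro eq_matI) (auto simp: cdiag_index[of _ n n] algebra_simps sum_subtractf)

lemma cdiag_mult_left:
  assumes "S \<in> carrier_mat n n" "T \<in> carrier_mat n n"
  shows "cdiag n (S * T) d = S * cdiag n T d * mat_adjoint S"
  using assms unfolding cdiag_def
  by (simp add: mat_adjoint_mult[of _ n n _ n] assoc_mult_mat_square[of _ n] mult_carrier_mat[of _ n n])

text \<open>With square roots as column factors, positive weights can be shifted between
  \<open>T\<close> and the diagonal.\<close>

lemma cdiag_mult_right: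
  assumes "T \<in> carrier_mat n n"
  shows "cdiag n (T * mat_diag n (\<lambda>i. complex_of_real (s i))) d = cdiag n T (\<lambda>i. d i * (s i)\<^sup>2)"
  using assms
  by (intro eq_matI)
     (auto simp: cdiag_index[of _ n] mult_carrier_mat[of _ n n] mat_diag_mult_right[of _ n] power2_eq_square
       algebra_simps intro!: sum.cong)

lemma cdiag_one:
  "T \<in> carrier_mat n n \<Longrightarrow> cdiag n T (\<lambda>i. 1) = T * mat_adjoint T"
  unfolding cdiag_def by simp

lemma cdiag_cong: "(\<And>i. i < n \<Longrightarrow> d i = e i) \<Longrightarrow> cdiag n T d = cdiag n T e"
proof -
  assume "\<And>i. i < n \<Longrightarrow> d i = e i"
  then have "mat_diag n (\<lambda>i. complex_of_real (d i)) = mat_diag n (\<lambda>i. complex_of_real (e i))"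
    unfolding mat_diag_def by (intro eq_matI) auto
  then show ?thesis unfolding cdiag_def by simp
qed

lemma cscalar_prod_adjoint:
  fixes A :: "complex mat"
  assumes "A \<in> carrier_mat n m" "v \<in> carrier_vec m" "w \<in> carrier_vec n"
  shows "(A *\<^sub>v v) \<bullet>c w = v \<bullet>c (mat_adjoint A *\<^sub>v w)"
proof -
  have "(A *\<^sub>v v) \<bullet>c w = (\<Sum>i<n. (\<Sum>k<m. A $$ (i, k) * vec_index v k) * cnj (vec_index w i))"
    using assms by (auto simp: scalar_prod_def lessThan_atLeast0 intro!: sum.cong)
  also have "\<dots> = (\<Sum>k<m. \<Sum>i<n. A $$ (i, k) * vec_index v k * cnj (vec_index w i))"
    by (subst sum.swap) (simp add: sum_distrib_right)
  also have "\<dots> = v \<bullet>c (mat_adjoint A *\<^sub>v w)"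
    using assms
    by (auto simp: scalar_prod_def lessThan_atLeast0 sum_distrib_left algebra_simps intro!: sum.cong)
  finally show ?thesis .
qed

lemma mat_diag_mult_vec:
  "w \<in> carrier_vec n \<Longrightarrow> i < n \<Longrightarrow> vec_index (mat_diag n d *\<^sub>v w) i = d i * (vec_index w i :: complex)"
  by (auto simp: mat_diag_def scalar_prod_def if_distrib[of "\<lambda>x. x * _"] cong: if_cong)

text \<open>Moving \<open>T\<close> across the inner product leaves a diagonal form at the adjoint
  of \<open>T\<close> applied to \<open>v\<close>. Comparing matrices that share \<open>T\<close>
  thereby becomes comparing weighted sums of squares.\<close>

lemma cdiag_form:
  assumes "T \<in> carrier_mat n n" "v \<in> carrier_vec n"
  shows "Re ((cdiag n T d *\<^sub>v v) \<bullet>c v) =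
    (\<Sum>i<n. d i * (cmod (vec_index (mat_adjoint T *\<^sub>v v) i))\<^sup>2)"
proof -
  let ?D = "mat_diag n (\<lambda>i. complex_of_real (d i))"
  let ?w = "mat_adjoint T *\<^sub>v v"
  have w: "?w \<in> carrier_vec n" using assms by (simp add: mult_mat_vec_carrier[of _ n n])
  have "cdiag n T d *\<^sub>v v = T *\<^sub>v (?D *\<^sub>v ?w)"
    unfolding cdiag_def using assms
    by (simp add: assoc_mult_mat_vec[of _ n n _ n] mult_carrier_mat[of _ n n] mult_mat_vec_carrier[of _ n n])
  then have "(cdiag n T d *\<^sub>v v) \<bullet>c v = (?D *\<^sub>v ?w) \<bullet>c ?w"
    using assms w by (simp add: cscalar_prod_adjoint[of T n n] mult_mat_vec_carrier[of _ n n])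
  also have "\<dots> = (\<Sum>i<n. of_real (d i) * (vec_index ?w i * cnj (vec_index ?w i)))"
    using w assms by (auto simp: scalar_prod_def lessThan_atLeast0 mat_diag_mult_vec simp del: index_mult_mat_vec intro!: sum.cong)
  finally show ?thesis
    by (simp add: complex_norm_square[symmetric] flip: of_real_power)
qed

section \<open>Unitary diagonalisation of Hermitian matrices\<close>

lemma eigenvector_exists:
  fixes A :: "complex mat"
  assumes "A \<in> carrier_mat n n" "n > 0"
  obtains v e where "v \<in> carrier_vec n" "v \<noteq> 0\<^sub>v n" "A *\<^sub>v v = e \<cdot>\<^sub>v v"
  using spectrum_non_empty[OF assms] assms
  unfolding spectrum_def eigenvalue_def eigenvector_def by auto

text \<open>Gram-Schmidt, applied to a basis that starts with \<open>v\<close>, keeps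
  \<open>v\<close> as first vector. Normalising the resulting orthogonal vectors gives the columns
  of \<open>W\<close> and accounts for the factor \<open>c\<close>.\<close>

lemma unitary_completion:
  fixes v :: "complex vec"
  assumes v: "v \<in> carrier_vec n" and v0: "v \<noteq> 0\<^sub>v n"
  obtains W c where "W \<in> carrier_mat n n" "mat_adjoint W * W = 1\<^sub>m n" "c \<noteq> 0" "col W 0 = c \<cdot>\<^sub>v v"
proof -
  interpret cof_vec_space n "TYPE(complex)" .
  have n: "n > 0" using v v0 by (cases n) auto
  define b where "b = basis_completion v"
  define ws where "ws = gram_schmidt n b"
  note bc = basis_completion[OF v v0, folded b_def]
  obtain vs where bv: "b = v # vs" using bc(6,7) n by (cases b) auto
  have ws: "corthogonal ws" "set ws \<subseteq> carrier_vec n" "length ws = n"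
    using gram_schmidt_result[OF bc(2,4,5) refl] bc(6) unfolding ws_def by auto
  have "hd ws = v" unfolding ws_def bv by (rule gram_schmidt_hd[OF v])
  then have ws0: "ws ! 0 = v" using ws n by (metis hd_conv_nth length_greater_0_conv)
  define r where "r w = complex_of_real (1 / sqrt (Re (w \<bullet>c w)))" for w :: "complex vec"
  define W where "W = mat_of_cols n (map (\<lambda>w. r w \<cdot>\<^sub>v w) ws)"
  have W: "W \<in> carrier_mat n n" unfolding W_def using ws by auto
  have wsi: "ws ! i \<in> carrier_vec n" if "i < n" for i using ws that by auto
  have colW: "col W i = r (ws ! i) \<cdot>\<^sub>v ws ! i" if "i < n" for i
    unfolding W_def using ws wsi that by (subst col_mat_of_cols) auto
  \<comment> \<open>\<open>corthogonal\<close> includes that each vector has a nonzero square, so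
    the norms to divide by are positive.\<close>
  have pos: "ws ! i \<bullet>c ws ! i = of_real (Re (ws ! i \<bullet>c ws ! i)) \<and> Re (ws ! i \<bullet>c ws ! i) > 0" if "i < n" for i
  proof -
    have "ws ! i \<bullet>c ws ! i \<noteq> 0" using corthogonalD[OF ws(1), of i i] ws that by auto
    moreover have "ws ! i \<bullet>c ws ! i \<ge> 0" by (rule conjugate_square_ge_0_vec)
    ultimately show ?thesis by (auto simp: less_eq_complex_def complex_eq_iff)
  qed
  have "mat_adjoint W * W = 1\<^sub>m n"
  proof (rule eq_matI)
    fix i j assume "i < dim_row (1\<^sub>m n :: complex mat)" "j < dim_col (1\<^sub>m n :: complex mat)"
    then have i: "i < n" and j: "j < n" by auto
    have "(mat_adjoint W * W) $$ (i, j) = col W j \<bullet>c col W i"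
      using W i j by (simp add: scalar_prod_def mat_adjoint_def mult.commute)
    also have "\<dots> = r (ws ! j) * cnj (r (ws ! i)) * (ws ! j \<bullet>c ws ! i)"
      unfolding colW[OF i] colW[OF j] using wsi[OF i] wsi[OF j]
      by (simp add: conjugate_smult_vec mult.assoc)
    also have "\<dots> = (if i = j then 1 else 0)"
    proof (cases "i = j")
      case True
      define x where "x = Re (ws ! j \<bullet>c ws ! j)"
      have x: "ws ! j \<bullet>c ws ! j = of_real x" "x > 0" using pos[OF j] unfolding x_def by auto
      have "r (ws ! j) * cnj (r (ws ! j)) * (ws ! j \<bullet>c ws ! j) = of_real (1 / sqrt x * (1 / sqrt x) * x)"
        unfolding r_def x_def[symmetric] x(1) by (simp only: of_real_mult complex_cnj_complex_of_real Re_complex_of_real)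
      also have "1 / sqrt x * (1 / sqrt x) * x = 1" using x(2) by (simp add: field_simps)
      finally show ?thesis using True by simp
    next
      case False
      then show ?thesis using corthogonalD[OF ws(1), of j i] i j ws by auto
    qed
    finally show "(mat_adjoint W * W) $$ (i, j) = 1\<^sub>m n $$ (i, j)" using i j by simp
  qed (use W in auto)
  moreover have "r v \<noteq> 0" using pos[OF n] unfolding r_def ws0 by simp
  ultimately show ?thesis using that W colW[OF n] ws0 by auto
qed

text \<open>Induction on the dimension: a unitary whose first column is proportional to an
  eigenvector splits off a 1 by 1 block, and the induction hypothesis diagonalises the remaining
  Hermitian block.\<close>

lemma spectral_theorem:
  assumes "hermitian_mat n A"
  obtains U d where "U \<in> carrier_mat n n" "mat_adjoint U * U = 1\<^sub>m n" "A = cdiag n U d"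
proof -
  have "\<exists>U d. U \<in> carrier_mat n n \<and> mat_adjoint U * U = 1\<^sub>m n \<and> A = cdiag n U d"
    using assms
  proof (induction n arbitrary: A)
    case 0
    then show ?case by (intro exI[of _ "1\<^sub>m 0"]) (auto simp: hermitian_mat_def intro!: eq_matI)
  next
    case (Suc n A)
    let ?n = "Suc n"
    have A: "A \<in> carrier_mat ?n ?n" and AA: "mat_adjoint A = A"
      using Suc.prems by (auto simp: hermitian_mat_def)
    obtain v e where v: "v \<in> carrier_vec ?n" "v \<noteq> 0\<^sub>v ?n" "A *\<^sub>v v = e \<cdot>\<^sub>v v"
      using eigenvector_exists[OF A] by auto
    obtain W c where W: "W \<in> carrier_mat ?n ?n" "mat_adjoint W * W = 1\<^sub>m ?n"
      and c: "c \<noteq> 0" "col W 0 = c \<cdot>\<^sub>v v"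
      using unitary_completion[OF v(1,2)] by metis
    have WW: "W * mat_adjoint W = 1\<^sub>m ?n"
      by (rule mat_mult_left_right_inverse) (use W in auto)
    define B where "B = mat_adjoint W * A * W"
    have B: "B \<in> carrier_mat ?n ?n" unfolding B_def using A W by (auto simp: mult_carrier_mat[of _ ?n ?n])
    have BB: "mat_adjoint B = B"
      unfolding B_def using A W AA
      by (simp add: mat_adjoint_mult[of _ ?n ?n _ ?n] assoc_mult_mat_square[of _ ?n] mult_carrier_mat[of _ ?n ?n])
    have ABW: "A = W * B * mat_adjoint W"
      unfolding B_def by (rule conjugation_cancel[symmetric]) (use A W WW in auto)
    have colc: "col W 0 \<in> carrier_vec ?n" by (rule col_carrier_vec) (use W(1) in simp_all)
    \<comment> \<open>The first column of \<open>W\<close> is an eigenvector of \<open>A\<close> for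
      \<open>e\<close>, so \<open>B\<close> maps the first unit vector to \<open>e\<close> times
      itself.\<close>
    have col0: "B $$ (i, 0) = (if i = 0 then e else 0)" if i: "i < ?n" for i
    proof -
      have "A *\<^sub>v col W 0 = e \<cdot>\<^sub>v col W 0"
        unfolding c using v A by (simp add: mult_mat_vec[of A ?n ?n] smult_smult_assoc mult.commute)
      then have "mat_adjoint W *\<^sub>v (A *\<^sub>v col W 0) = e \<cdot>\<^sub>v (mat_adjoint W *\<^sub>v col W 0)"
        using W by (simp add: mult_mat_vec[of _ ?n ?n] colc)
      moreover have "mat_adjoint W *\<^sub>v (A *\<^sub>v col W 0) = col B 0"
        unfolding B_def using A W
        by (simp add: col_mult2[of _ ?n ?n _ ?n] assoc_mult_mat_vec[of _ ?n ?n _ ?n] mult_carrier_mat[of _ ?n ?n] colc)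
      moreover have "mat_adjoint W *\<^sub>v col W 0 = col (1\<^sub>m ?n) 0"
        using W by (simp add: col_mult2[of _ ?n ?n _ ?n, symmetric])
      ultimately have "col B 0 = e \<cdot>\<^sub>v col (1\<^sub>m ?n) 0" by simp
      from arg_cong[OF this, of "\<lambda>u. vec_index u i"] show ?thesis using B i by auto
    qed
    have herm: "B $$ (i, j) = cnj (B $$ (j, i))" if "i < ?n" "j < ?n" for i j
      using arg_cong[OF BB, of "\<lambda>M. M $$ (i, j)"] B that by auto
    have e: "e = of_real (Re e)"
      using herm[of 0 0] col0[of 0] by (auto simp: complex_eq_iff)
    \<comment> \<open>Hermitian symmetry carries the zeros of the first column over to the first
      row, which makes \<open>B\<close> block diagonal.\<close>
    have row0: "B $$ (0, i) = (if i = 0 then e else 0)" if i: "i < ?n" for i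
      using herm[of 0 i] col0[of i] i herm[of 0 0] col0[of 0] by auto
    define A3 where "A3 = Matrix.mat n n (\<lambda>(i, j). B $$ (Suc i, Suc j))"
    have "hermitian_mat n A3"
      unfolding hermitian_mat_def A3_def by (auto intro!: eq_matI herm[symmetric])
    from Suc.IH[OF this] obtain U3 d3 where U3: "U3 \<in> carrier_mat n n"
      "mat_adjoint U3 * U3 = 1\<^sub>m n" "A3 = cdiag n U3 d3" by blast
    \<comment> \<open>\<open>P\<close> is block diagonal with blocks 1 and \<open>U3\<close>; the
      product \<open>W * P\<close> will diagonalise \<open>A\<close>.\<close>
    define P where "P = Matrix.mat ?n ?n (\<lambda>(i, j). case (i, j) of
       (0, 0) \<Rightarrow> 1 | (Suc i, Suc j) \<Rightarrow> U3 $$ (i, j) | _ \<Rightarrow> 0)"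
    define d where "d i = (case i of 0 \<Rightarrow> Re e | Suc i \<Rightarrow> d3 i)" for i
    have P: "P \<in> carrier_mat ?n ?n" unfolding P_def by auto
    have P0S: "P $$ (0, Suc i) = 0" and PS0: "P $$ (Suc i, 0) = 0"
      and PSS: "P $$ (Suc i, Suc j) = U3 $$ (i, j)" if "i < n" "j < n" for i j
      unfolding P_def using that by auto
    have P00: "P $$ (0, 0) = 1" unfolding P_def by auto
    have PP: "mat_adjoint P * P = 1\<^sub>m ?n"
    proof (rule eq_matI)
      fix i j assume "i < dim_row (1\<^sub>m ?n :: complex mat)" "j < dim_col (1\<^sub>m ?n :: complex mat)"
      then have i: "i < ?n" and j: "j < ?n" by auto
      have "(mat_adjoint P * P) $$ (i, j) = (\<Sum>k<?n. cnj (P $$ (k, i)) * P $$ (k, j))"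
        using P i j by (subst mat_mult_index[where n="?n"]) auto
      also have "\<dots> = cnj (P $$ (0, i)) * P $$ (0, j) + (\<Sum>k<n. cnj (P $$ (Suc k, i)) * P $$ (Suc k, j))"
        by (rule sum.lessThan_Suc_shift)
      also have "\<dots> = 1\<^sub>m ?n $$ (i, j)"
      proof (cases i; cases j)
        fix i' j' assume ij: "i = Suc i'" "j = Suc j'"
        then have "(\<Sum>k<n. cnj (P $$ (Suc k, i)) * P $$ (Suc k, j)) = (mat_adjoint U3 * U3) $$ (i', j')"
          using U3 i j by (subst mat_mult_index[where n=n]) (auto simp: PSS)
        then show ?thesis using ij i j U3 P0S by auto
      qed (use i j P0S PS0 P00 in auto)
      finally show "(mat_adjoint P * P) $$ (i, j) = 1\<^sub>m ?n $$ (i, j)" .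
    qed (use P in auto)
    have BP: "B = cdiag ?n P d"
    proof (rule eq_matI)
      fix i j assume "i < dim_row (cdiag ?n P d)" "j < dim_col (cdiag ?n P d)"
      then have i: "i < ?n" and j: "j < ?n" using cdiag_carrier[OF P, of d] by auto
      have "cdiag ?n P d $$ (i, j) = (\<Sum>k<?n. of_real (d k) * P $$ (i, k) * cnj (P $$ (j, k)))"
        using P i j by (rule cdiag_index)
      also have "\<dots> = of_real (d 0) * P $$ (i, 0) * cnj (P $$ (j, 0)) +
          (\<Sum>k<n. of_real (d (Suc k)) * P $$ (i, Suc k) * cnj (P $$ (j, Suc k)))"
        by (rule sum.lessThan_Suc_shift)
      also have "\<dots> = B $$ (i, j)"
      proof (cases i; cases j)
        fix i' j' assume ij: "i = Suc i'" "j = Suc j'"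
        then have "(\<Sum>k<n. of_real (d (Suc k)) * P $$ (i, Suc k) * cnj (P $$ (j, Suc k))) = cdiag n U3 d3 $$ (i', j')"
          using U3 i j by (subst cdiag_index[where m=n]) (auto simp: PSS d_def)
        also have "\<dots> = A3 $$ (i', j')" using U3(3) by simp
        finally show ?thesis using ij i j PS0 unfolding A3_def by auto
      qed (use i j P0S PS0 P00 col0 row0 e[symmetric] in \<open>auto simp: d_def\<close>)
      finally show "B $$ (i, j) = cdiag ?n P d $$ (i, j)" by simp
    qed (use B cdiag_carrier[OF P, of d] in auto)
    have "A = cdiag ?n (W * P) d" unfolding ABW BP cdiag_mult_left[OF W(1) P] ..
    moreover have "mat_adjoint (W * P) * (W * P) = 1\<^sub>m ?n"
      using W P PP by (simp add: mat_adjoint_mult[of _ ?n ?n _ ?n] assoc_mult_mat_square[of _ ?n]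
          mult_carrier_mat[of _ ?n ?n] mult_cancel_inverse[OF _ _ W(2)])
    ultimately show ?case using W P by (intro exI[of _ "W * P"] exI[of _ d]) auto
  qed
  then show ?thesis using that by blast
qed

section \<open>Functional calculus and operator means of simultaneously diagonalised matrices\<close>

abbreviation real_diag :: "nat \<Rightarrow> (nat \<Rightarrow> real) \<Rightarrow> complex mat" where
  "real_diag n d \<equiv> mat_diag n (\<lambda>i. complex_of_real (d i))"

definition invertible_square :: "nat \<Rightarrow> complex mat \<Rightarrow> bool" where
  "invertible_square n T \<longleftrightarrow> T \<in> carrier_mat n n \<and> (\<exists>S \<in> carrier_mat n n. T * S = 1\<^sub>m n \<and> S * T = 1\<^sub>m n)"

lemma invertible_squareD [simp]: "invertible_square n T \<Longrightarrow> T \<in> carrier_mat n n"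
  unfolding invertible_square_def by simp

lemma unitary_right_inverse:
  fixes U :: "complex mat"
  assumes "U \<in> carrier_mat n n" "mat_adjoint U * U = 1\<^sub>m n"
  shows "U * mat_adjoint U = 1\<^sub>m n"
  by (rule mat_mult_left_right_inverse) (use assms in auto)

lemma invertible_square_unitary:
  fixes U :: "complex mat"
  assumes "U \<in> carrier_mat n n" "mat_adjoint U * U = 1\<^sub>m n"
  shows "invertible_square n U"
  using assms unitary_right_inverse[OF assms] mat_adjoint_carrier[OF assms(1)]
  unfolding invertible_square_def by blast

lemma invertible_square_mult:
  assumes "invertible_square n A" "invertible_square n B"
  shows "invertible_square n (A * B)"
proof -
  obtain A' B' where A: "A' \<in> carrier_mat n n" "A * A' = 1\<^sub>m n" "A' * A = 1\<^sub>m n"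
    and B: "B' \<in> carrier_mat n n" "B * B' = 1\<^sub>m n" "B' * B = 1\<^sub>m n"
    using assms unfolding invertible_square_def by blast
  have c: "A \<in> carrier_mat n n" "B \<in> carrier_mat n n" using assms by auto
  have "(A * B) * (B' * A') = 1\<^sub>m n" "(B' * A') * (A * B) = 1\<^sub>m n"
    using A B c by (simp_all add: assoc_mult_mat_square[of _ n] mult_carrier_mat[of _ n n]
        mult_cancel_inverse[OF _ _ B(2)] mult_cancel_inverse[OF _ _ A(3)])
  moreover have "A * B \<in> carrier_mat n n" "B' * A' \<in> carrier_mat n n"
    using A B c by (auto simp: mult_carrier_mat[of _ n n])
  ultimately show ?thesis unfolding invertible_square_def by blast
qed

lemma invertible_square_real_diag:
  assumes "\<And>i. i < n \<Longrightarrow> s i \<noteq> 0"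
  shows "invertible_square n (real_diag n s)"
proof -
  have "mat_diag n (\<lambda>i. complex_of_real (s i) * complex_of_real (1 / s i)) = 1\<^sub>m n"
    "mat_diag n (\<lambda>i. complex_of_real (1 / s i) * complex_of_real (s i)) = 1\<^sub>m n"
    using assms unfolding mat_diag_def by (auto intro!: eq_matI)
  then show ?thesis unfolding invertible_square_def
    by (auto intro!: bexI[of _ "real_diag n (\<lambda>i. 1 / s i)"] simp del: of_real_divide)
qed

lemma mat_adjoint_real_diag [simp]: "mat_adjoint (real_diag n d) = real_diag n d"
  by (rule eq_matI) (auto simp: mat_diag_def)

text \<open>Functional calculus is independent of the diagonalisation. The unitary \<open>W\<close>,
  the adjoint of \<open>V\<close> times \<open>U\<close>, intertwines the diagonals \<open>d\<close>
  and \<open>e\<close>, so a nonzero entry of \<open>W\<close> at \<open>(i, j)\<close> forces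
  \<open>d j = e i\<close>. Hence \<open>W\<close> also intertwines the diagonals after
  \<open>h\<close> is applied.\<close>

lemma cdiag_eq_imp_mat_fun_eq:
  assumes U: "U \<in> carrier_mat n n" "mat_adjoint U * U = 1\<^sub>m n"
    and V: "V \<in> carrier_mat n n" "mat_adjoint V * V = 1\<^sub>m n"
    and eq: "cdiag n U d = cdiag n V e"
  shows "cdiag n U (\<lambda>i. h (d i)) = cdiag n V (\<lambda>i. h (e i))"
proof -
  note UU = unitary_right_inverse[OF U] and VV = unitary_right_inverse[OF V]
  note simps = assoc_mult_mat_square[of _ n] mult_carrier_mat[of _ n n]
  define W where "W = mat_adjoint V * U"
  have W: "W \<in> carrier_mat n n" unfolding W_def using U V by (auto simp: mult_carrier_mat[of _ n n])
  have "mat_adjoint V * cdiag n U d * U = mat_adjoint V * cdiag n V e * U" using eq by simp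
  then have WD: "W * real_diag n d = real_diag n e * W"
    unfolding W_def cdiag_def using U V
    by (simp add: simps mult_cancel_inverse[OF _ _ V(2)] right_mult_one_mat[of _ n n])
  have ent: "W $$ (i, j) * of_real (d j) = of_real (e i) * W $$ (i, j)" if "i < n" "j < n" for i j
    using that W arg_cong[OF WD, of "\<lambda>M. M $$ (i, j)"]
    by (simp add: mat_diag_mult_left[of _ n n] mat_diag_mult_right[of _ n n])
  have "W * real_diag n (\<lambda>i. h (d i)) = real_diag n (\<lambda>i. h (e i)) * W"
  proof (rule eq_matI)
    fix i j
    assume "i < dim_row (real_diag n (\<lambda>i. h (e i)) * W)" "j < dim_col (real_diag n (\<lambda>i. h (e i)) * W)"
    then have ij: "i < n" "j < n" using W by (auto simp: mat_diag_def)
    then show "(W * real_diag n (\<lambda>i. h (d i))) $$ (i, j) = (real_diag n (\<lambda>i. h (e i)) * W) $$ (i, j)"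
      using ent[OF ij] W
      by (cases "W $$ (i, j) = 0") (auto simp: mat_diag_mult_left[of _ n n] mat_diag_mult_right[of _ n n])
  qed (use W in \<open>auto simp: mat_diag_def\<close>)
  then have "V * (W * real_diag n (\<lambda>i. h (d i))) * mat_adjoint U = V * (real_diag n (\<lambda>i. h (e i)) * W) * mat_adjoint U"
    by simp
  then show ?thesis
    unfolding W_def cdiag_def using U V UU
    by (simp add: simps mult_cancel_inverse[OF _ _ VV])
qed

text \<open>The given decomposition is itself a witness for the definite description, and the
  preceding lemma supplies uniqueness.\<close>

lemma mat_fun_cdiag:
  assumes U: "U \<in> carrier_mat n n" "mat_adjoint U * U = 1\<^sub>m n"
  shows "mat_fun h (cdiag n U d) = cdiag n U (\<lambda>i. h (d i))"
proof -
  have dim: "dim_row (cdiag n U d) = n" using U by simp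
  show ?thesis
    unfolding mat_fun_def Let_def dim cdiag_def[symmetric]
  proof (rule the_equality)
    fix B
    assume "\<exists>V e. V \<in> carrier_mat n n \<and> mat_adjoint V * V = 1\<^sub>m n \<and>
      cdiag n U d = cdiag n V e \<and> B = cdiag n V (\<lambda>i. h (e i))"
    then show "B = cdiag n U (\<lambda>i. h (d i))"
      using cdiag_eq_imp_mat_fun_eq[OF U] by metis
  qed (use U in blast)
qed

lemma mat_fun_hermitian:
  assumes "hermitian_mat n A" shows "hermitian_mat n (mat_fun h A)"
  using spectral_theorem[OF assms] by (metis mat_fun_cdiag cdiag_hermitian)

section \<open>The Loewner order in terms of quadratic forms\<close>

lemma mat_adjoint_minus:
  fixes A B :: "complex mat"
  shows "A \<in> carrier_mat n m \<Longrightarrow> B \<in> carrier_mat n m \<Longrightarrow> mat_adjoint (A - B) = mat_adjoint A - mat_adjoint B"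
  by (rule eq_matI) auto

lemma form_minus:
  fixes X Y :: "complex mat"
  assumes "X \<in> carrier_mat n n" "Y \<in> carrier_mat n n" "v \<in> carrier_vec n"
  shows "Re (((Y - X) *\<^sub>v v) \<bullet>c v) = Re ((Y *\<^sub>v v) \<bullet>c v) - Re ((X *\<^sub>v v) \<bullet>c v)"
  using assms by (simp add: minus_mult_distrib_mat_vec[of _ n n] minus_scalar_prod_distrib[of _ n] mult_mat_vec_carrier[of _ n n])

text \<open>The form is additive in the matrix, so order arguments such as transitivity and passage
  to limits reduce to real inequalities for each fixed vector.\<close>

lemma loewner_le_iff:
  assumes "hermitian_mat n X" "hermitian_mat n Y"
  shows "loewner_le n X Y \<longleftrightarrow>
    (\<forall>v \<in> carrier_vec n. Re ((X *\<^sub>v v) \<bullet>c v) \<le> Re ((Y *\<^sub>v v) \<bullet>c v))"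
  using assms unfolding loewner_le_def psd_mat_def hermitian_mat_def
  by (auto simp: mat_adjoint_minus[of _ n n] form_minus)

lemma loewner_less_iff:
  assumes "hermitian_mat n X" "hermitian_mat n Y"
  shows "loewner_less n X Y \<longleftrightarrow>
    (\<forall>v \<in> carrier_vec n. v \<noteq> 0\<^sub>v n \<longrightarrow> Re ((X *\<^sub>v v) \<bullet>c v) < Re ((Y *\<^sub>v v) \<bullet>c v))"
  using assms unfolding loewner_less_def pd_mat_def hermitian_mat_def
  by (auto simp: mat_adjoint_minus[of _ n n] form_minus)

lemma loewner_le_trans:
  assumes "hermitian_mat n X" "hermitian_mat n Y" "hermitian_mat n Z"
    "loewner_le n X Y" "loewner_le n Y Z"
  shows "loewner_le n X Z"
  using assms by (meson loewner_le_iff order_trans)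

lemma adjoint_mult_vec_nonzero:
  assumes "invertible_square n T" "v \<in> carrier_vec n" "v \<noteq> 0\<^sub>v n"
  shows "\<exists>i<n. vec_index (mat_adjoint T *\<^sub>v v) i \<noteq> 0"
proof (rule ccontr)
  assume "\<not> ?thesis"
  then have z: "mat_adjoint T *\<^sub>v v = 0\<^sub>v n" using invertible_squareD[OF assms(1)] by (intro eq_vecI) auto
  obtain S where S: "S \<in> carrier_mat n n" "T * S = 1\<^sub>m n"
    using assms unfolding invertible_square_def by blast
  have "mat_adjoint S * mat_adjoint T = 1\<^sub>m n"
    using S assms by (subst mat_adjoint_mult[symmetric, of _ n n _ n]) auto
  then have "v = mat_adjoint S *\<^sub>v (mat_adjoint T *\<^sub>v v)"
    using S assms by (subst assoc_mult_mat_vec[symmetric, of _ n n _ n]) auto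
  also have "\<dots> = 0\<^sub>v n" unfolding z using S by (intro eq_vecI) (auto simp: scalar_prod_def)
  finally show False using assms by simp
qed

lemma pd_cdiag:
  assumes "invertible_square n T" "\<And>i. i < n \<Longrightarrow> 0 < d i"
  shows "pd_mat n (cdiag n T d)"
  unfolding pd_mat_def
proof (intro conjI ballI impI)
  fix v :: "complex vec" assume v: "v \<in> carrier_vec n" "v \<noteq> 0\<^sub>v n"
  obtain i where i: "i < n" "vec_index (mat_adjoint T *\<^sub>v v) i \<noteq> 0"
    using adjoint_mult_vec_nonzero[OF assms(1) v] by blast
  show "0 < Re ((cdiag n T d *\<^sub>v v) \<bullet>c v)"
    unfolding cdiag_form[OF invertible_squareD[OF assms(1)] v(1)]
    by (rule sum_pos2[of _ i]) (use i assms in \<open>auto simp: less_imp_le\<close>)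
qed (use assms in auto)

text \<open>If \<open>S\<close> is the inverse of \<open>T\<close>, the adjoint of \<open>S\<close>
  sends the unit vector \<open>i\<close> to a vector that the adjoint of \<open>T\<close> sends
  back. One such \<open>v\<close> serves all \<open>d\<close> at once, so positivity and order of
  congruent diagonals can be read off entrywise.\<close>

lemma cdiag_form_unit:
  assumes T: "invertible_square n T" and i: "i < n"
  obtains v where "v \<in> carrier_vec n" "v \<noteq> 0\<^sub>v n" "\<And>d. Re ((cdiag n T d *\<^sub>v v) \<bullet>c v) = d i"
proof -
  obtain S where S: "S \<in> carrier_mat n n" "S * T = 1\<^sub>m n"
    using T unfolding invertible_square_def by blast
  note Tc = invertible_squareD[OF T]
  define v where "v = mat_adjoint S *\<^sub>v unit_vec n i"
  have "mat_adjoint T * mat_adjoint S = 1\<^sub>m n"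
    using S Tc by (subst mat_adjoint_mult[symmetric, of _ n n _ n]) auto
  then have Tv: "mat_adjoint T *\<^sub>v v = unit_vec n i"
    unfolding v_def using S Tc i by (subst assoc_mult_mat_vec[symmetric, of _ n n _ n]) auto
  have v: "v \<in> carrier_vec n" unfolding v_def using S by (simp add: mult_mat_vec_carrier[of _ n n])
  have form: "Re ((cdiag n T d *\<^sub>v v) \<bullet>c v) = d i" for d
  proof -
    have "Re ((cdiag n T d *\<^sub>v v) \<bullet>c v) = (\<Sum>k<n. if k = i then d i else 0)"
      unfolding cdiag_form[OF Tc v] Tv by (intro sum.cong) (auto simp: i)
    then show ?thesis using i by simp
  qed
  \<comment> \<open>At the zero vector every form vanishes, but the constant diagonal 1 gives the
    value 1 at \<open>v\<close>.\<close>
  have "v \<noteq> 0\<^sub>v n"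
  proof
    assume "v = 0\<^sub>v n"
    then have "Re ((cdiag n T (\<lambda>_. 1) *\<^sub>v v) \<bullet>c v) = 0" using Tc by (simp add: mult_mat_vec_carrier[of _ n n])
    then show False unfolding form by simp
  qed
  then show ?thesis using that v form by blast
qed

lemma pd_cdiagD:
  assumes "invertible_square n T" "pd_mat n (cdiag n T d)" "i < n"
  shows "0 < d i"
  using cdiag_form_unit[OF assms(1,3)] assms(2) unfolding pd_mat_def by metis

lemma loewner_le_cdiagD:
  assumes "invertible_square n T" "loewner_le n (cdiag n T x) (cdiag n T y)" "i < n"
  shows "x i \<le> y i"
proof -
  note Tc = invertible_squareD[OF assms(1)]
  obtain v where "v \<in> carrier_vec n" "\<And>d. Re ((cdiag n T d *\<^sub>v v) \<bullet>c v) = d i"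
    using cdiag_form_unit[OF assms(1,3)] by metis
  then show ?thesis
    using assms(2) loewner_le_iff[OF cdiag_hermitian[OF Tc] cdiag_hermitian[OF Tc]] by metis
qed

lemma loewner_less_cdiag:
  assumes "invertible_square n T" "\<And>i. i < n \<Longrightarrow> x i < y i"
  shows "loewner_less n (cdiag n T x) (cdiag n T y)"
  unfolding loewner_less_def using assms
  by (auto simp: cdiag_minus intro: pd_cdiag)

lemma loewner_less_cdiagD:
  assumes "invertible_square n T" "loewner_less n (cdiag n T x) (cdiag n T y)" "i < n"
  shows "x i < y i"
  using pd_cdiagD[OF assms(1) _ assms(3), of "\<lambda>i. y i - x i"] assms
  unfolding loewner_less_def by (auto simp: cdiag_minus)

section \<open>Simultaneous diagonalisation and operator means\<close>

lemma hermitian_congruence: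
  assumes "hermitian_mat n A" "P \<in> carrier_mat n n"
  shows "hermitian_mat n (P * A * mat_adjoint P)"
  using assms unfolding hermitian_mat_def
  by (auto simp: mat_adjoint_mult[of _ n n _ n] mult_carrier_mat[of _ n n] assoc_mult_mat_square[of _ n])

text \<open>Factor \<open>X\<close> as \<open>P\<close> times its adjoint, pull \<open>Y\<close>
  back by the inverse \<open>Q\<close> of \<open>P\<close>, and diagonalise the result by a unitary
  \<open>V\<close>. Then \<open>T = P * V\<close> works for both, since \<open>V\<close> cancels
  against its adjoint in \<open>X\<close>.\<close>

lemma simultaneous_cdiag:
  assumes X: "pd_mat n X" and Y: "hermitian_mat n Y"
  obtains T y where "invertible_square n T" "X = cdiag n T (\<lambda>i. 1)" "Y = cdiag n T y"
proof -
  obtain U d where U: "U \<in> carrier_mat n n" "mat_adjoint U * U = 1\<^sub>m n" and XU: "X = cdiag n U d"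
    using spectral_theorem X unfolding pd_mat_def by metis
  have d: "d i > 0" if "i < n" for i
    using pd_cdiagD[OF invertible_square_unitary[OF U], of d i] X XU that by simp
  define P where "P = U * real_diag n (\<lambda>i. sqrt (d i))"
  have P: "invertible_square n P"
    unfolding P_def using U d
    by (intro invertible_square_mult invertible_square_unitary invertible_square_real_diag) (auto dest: d)
  note Pc = invertible_squareD[OF P]
  have XP: "X = cdiag n P (\<lambda>i. 1)"
    unfolding P_def XU cdiag_mult_right[OF U(1)] by (rule cdiag_cong) (use d in \<open>auto simp: less_imp_le\<close>)
  obtain Q where Q: "Q \<in> carrier_mat n n" "P * Q = 1\<^sub>m n" "Q * P = 1\<^sub>m n"
    using P unfolding invertible_square_def by blast
  have Yc: "Y \<in> carrier_mat n n" using Y unfolding hermitian_mat_def by simp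
  obtain V z where V: "V \<in> carrier_mat n n" "mat_adjoint V * V = 1\<^sub>m n"
    and Z: "Q * Y * mat_adjoint Q = cdiag n V z"
    using spectral_theorem[OF hermitian_congruence[OF Y Q(1)]] by metis
  have QP: "mat_adjoint Q * mat_adjoint P = 1\<^sub>m n"
    using Q Pc by (subst mat_adjoint_mult[symmetric, of _ n n _ n]) auto
  have "cdiag n (P * V) z = P * (Q * Y * mat_adjoint Q) * mat_adjoint P"
    unfolding Z using Pc V by (simp add: cdiag_mult_left)
  also have "\<dots> = Y"
    using Q Pc Yc QP
    by (simp add: assoc_mult_mat_square[of _ n] mult_carrier_mat[of _ n n] mult_cancel_inverse[OF _ _ Q(2)])
  finally have "Y = cdiag n (P * V) z" by simp
  moreover have "cdiag n (P * V) (\<lambda>i. 1) = X"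
    unfolding XP using Pc V
    by (simp add: cdiag_mult_left cdiag_one[of _ n] unitary_right_inverse[OF V])
  ultimately show ?thesis
    using that P V by (metis invertible_square_mult invertible_square_unitary)
qed

text \<open>The square root \<open>R\<close> of \<open>A\<close> and the factor \<open>Q\<close>,
  which is \<open>T\<close> with columns scaled by the roots of \<open>a\<close>, both give
  \<open>A\<close> when multiplied by their adjoints. They therefore differ by a unitary
  \<open>W\<close>, which diagonalises the matrix inside the mean with eigenvalues
  \<open>b i / a i\<close>.\<close>

lemma op_mean_cdiag:
  assumes T: "invertible_square n T" and a: "\<And>i. i < n \<Longrightarrow> 0 < a i"
  shows "op_mean h (cdiag n T a) (cdiag n T b) = cdiag n T (\<lambda>i. a i * h (b i / a i))"
proof -
  note simps = assoc_mult_mat_square[of _ n] mult_carrier_mat[of _ n n]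
  note Tc = invertible_squareD[OF T]
  define A where "A = cdiag n T a"
  have "pd_mat n A" unfolding A_def by (rule pd_cdiag[OF T a])
  then obtain U d where U: "U \<in> carrier_mat n n" "mat_adjoint U * U = 1\<^sub>m n" and AU: "A = cdiag n U d"
    using spectral_theorem unfolding pd_mat_def by metis
  have d: "d i > 0" if "i < n" for i
    using pd_cdiagD[OF invertible_square_unitary[OF U], of d i] \<open>pd_mat n A\<close> AU that by simp
  define R where "R = mat_fun sqrt A"
  define S where "S = mat_fun (\<lambda>t. 1 / sqrt t) A"
  have R: "R = cdiag n U (\<lambda>i. sqrt (d i))" and S: "S = cdiag n U (\<lambda>i. 1 / sqrt (d i))"
    unfolding R_def S_def AU by (rule mat_fun_cdiag[OF U])+
  have Rc: "R \<in> carrier_mat n n" and Sc: "S \<in> carrier_mat n n" unfolding R S using U by auto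
  have Ra: "mat_adjoint R = R" and Sa: "mat_adjoint S = S"
    using cdiag_hermitian[OF U(1)] unfolding R S hermitian_mat_def by auto
  have mult: "cdiag n U p * cdiag n U q = cdiag n U (\<lambda>i. p i * q i)" for p q
    unfolding cdiag_def using U
    by (simp add: simps mult_cancel_inverse[OF _ _ U(2)])
      (simp add: assoc_mult_mat_square[of _ n, symmetric] simps(2))
  have one: "cdiag n U (\<lambda>i. 1) = 1\<^sub>m n"
    using U unitary_right_inverse[OF U] by (simp add: cdiag_one)
  have RS: "R * S = 1\<^sub>m n" and SR: "S * R = 1\<^sub>m n"
    unfolding R S mult one[symmetric] by (rule cdiag_cong; use d in force)+
  have RR: "R * R = A"
    unfolding R mult AU by (rule cdiag_cong) (use d in \<open>auto simp: less_imp_le\<close>)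
  define Q where "Q = T * real_diag n (\<lambda>i. sqrt (a i))"
  have Q: "Q \<in> carrier_mat n n" unfolding Q_def using Tc by (auto simp: simps(2))
  have QQ: "Q * mat_adjoint Q = A"
    unfolding cdiag_one[OF Q, symmetric] A_def unfolding Q_def cdiag_mult_right[OF Tc]
    by (rule cdiag_cong) (use a in \<open>auto simp: less_imp_le\<close>)
  have TQ: "T = Q * real_diag n (\<lambda>i. 1 / sqrt (a i))"
  proof -
    have "mat_diag n (\<lambda>i. complex_of_real (sqrt (a i)) * complex_of_real (1 / sqrt (a i))) = 1\<^sub>m n"
      using a unfolding mat_diag_def by (intro eq_matI) (auto dest: a)
    then show ?thesis unfolding Q_def using Tc by (simp add: simps del: of_real_divide)
  qed
  \<comment> \<open>\<open>S\<close> is the inverse of \<open>R\<close>, so \<open>R * W = Q\<close>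
    is the polar decomposition of \<open>Q\<close>.\<close>
  define W where "W = S * Q"
  have W: "W \<in> carrier_mat n n" unfolding W_def using Q Sc by (auto simp: simps(2))
  have "W * mat_adjoint W = S * (Q * mat_adjoint Q) * S"
    unfolding W_def using Q Sc Sa by (simp add: mat_adjoint_mult[of _ n n _ n] simps)
  also have "\<dots> = 1\<^sub>m n"
    unfolding QQ RR[symmetric] using Rc Sc RS by (simp add: simps mult_cancel_inverse[OF _ _ SR])
  finally have WW: "mat_adjoint W * W = 1\<^sub>m n"
    using W by (intro mat_mult_left_right_inverse[of W n]) auto
  have ST: "S * T = W * real_diag n (\<lambda>i. 1 / sqrt (a i))"
    unfolding W_def by (subst TQ) (use Q Sc in \<open>simp add: simps del: of_real_divide\<close>)
  have "S * cdiag n T b * S = cdiag n (S * T) b"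
    unfolding cdiag_mult_left[OF Sc Tc] Sa ..
  also have "\<dots> = cdiag n W (\<lambda>i. b i / a i)"
    unfolding ST cdiag_mult_right[OF W]
    by (rule cdiag_cong) (use a in \<open>auto simp: less_imp_le power_divide\<close>)
  finally have SBS: "S * cdiag n T b * S = cdiag n W (\<lambda>i. b i / a i)" .
  have RW: "R * W = Q"
    unfolding W_def using Rc Sc Q by (simp add: mult_cancel_inverse[OF _ _ RS])
  have "R * mat_fun h (S * cdiag n T b * S) * R = cdiag n (R * W) (\<lambda>i. h (b i / a i))"
    unfolding SBS mat_fun_cdiag[OF W WW] cdiag_mult_left[OF Rc W] Ra ..
  also have "\<dots> = cdiag n T (\<lambda>i. a i * h (b i / a i))"
    unfolding RW unfolding Q_def cdiag_mult_right[OF Tc]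
    by (rule cdiag_cong) (use a in \<open>auto simp: less_imp_le mult.commute\<close>)
  finally show ?thesis
    unfolding op_mean_def Let_def A_def[symmetric] R_def[symmetric] S_def[symmetric] .
qed

lemma invertible_square_one [simp]: "invertible_square n (1\<^sub>m n)"
  unfolding invertible_square_def by (auto intro!: bexI[of _ "1\<^sub>m n"])

section \<open>Continuity of functions monotone for the strict Loewner order\<close>

text \<open>The cross term \<open>2 * c * x * y\<close> of the rotated form is absorbed by
  completing a square with weight \<open>e\<close>, at the cost of \<open>c\<^sup>2 / e\<close> in
  the coefficient of \<open>y\<^sup>2\<close>. The bound of \<open>c\<^sup>2\<close> by
  \<open>(a + b)\<^sup>2\<close> removes \<open>p\<close> and \<open>q\<close> from that
  coefficient, and the summand 1 makes the inequality strict when \<open>y\<close> is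
  nonzero.\<close>

lemma rotation_form_less:
  fixes p q a b e x y :: real
  assumes pq: "p\<^sup>2 + q\<^sup>2 = 1" and a: "0 < a" and b: "0 < b" and e: "0 < e" and nz: "x \<noteq> 0 \<or> y \<noteq> 0"
  shows "a * (p * x + q * y)\<^sup>2 + b * (p * y - q * x)\<^sup>2 <
    (p\<^sup>2 * a + q\<^sup>2 * b + e) * x\<^sup>2 + (a + b + (a + b)\<^sup>2 / e + 1) * y\<^sup>2"
proof -
  define c where "c = p * q * (a - b)"
  have p1: "p\<^sup>2 \<le> 1" and q1: "q\<^sup>2 \<le> 1" using pq by (simp_all add: sum_power2_le_zero_iff flip: pq)
  have "a * q\<^sup>2 \<le> a" "b * p\<^sup>2 \<le> b" using a b p1 q1 by (simp_all add: mult_left_le)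
  then have K: "(a * q\<^sup>2 + b * p\<^sup>2) * y\<^sup>2 \<le> (a + b) * y\<^sup>2" by (intro mult_right_mono) auto
  have "c\<^sup>2 = (p\<^sup>2 * q\<^sup>2) * (a - b)\<^sup>2" unfolding c_def by (simp add: power_mult_distrib)
  also have "\<dots> \<le> 1 * (a + b)\<^sup>2"
  proof (intro mult_mono)
    show "p\<^sup>2 * q\<^sup>2 \<le> 1" using p1 q1 by (simp add: mult_le_one)
    show "(a - b)\<^sup>2 \<le> (a + b)\<^sup>2" using a b by (simp add: power2_eq_square algebra_simps)
  qed auto
  finally have c2: "c\<^sup>2 / e * y\<^sup>2 \<le> (a + b)\<^sup>2 / e * y\<^sup>2"
    using e by (intro mult_right_mono divide_right_mono) auto
  have "0 < (e * x - c * y)\<^sup>2 / e + y\<^sup>2"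
  proof (cases "y = 0")
    case True
    then show ?thesis using nz e by simp
  next
    case False
    then show ?thesis using e by (intro add_nonneg_pos) auto
  qed
  also have "(e * x - c * y)\<^sup>2 / e = e * x\<^sup>2 - 2 * c * x * y + c\<^sup>2 / e * y\<^sup>2"
    using e by (simp add: power2_eq_square field_simps)
  finally have 1: "0 < e * x\<^sup>2 - 2 * c * x * y + c\<^sup>2 / e * y\<^sup>2 + y\<^sup>2" .
  have "a * (p * x + q * y)\<^sup>2 + b * (p * y - q * x)\<^sup>2 =
      (p\<^sup>2 * a + q\<^sup>2 * b) * x\<^sup>2 + (a * q\<^sup>2 + b * p\<^sup>2) * y\<^sup>2 + 2 * c * x * y"
    unfolding c_def by (simp add: power2_eq_square algebra_simps)
  then show ?thesis using 1 K c2 by (simp add: algebra_simps)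
qed

text \<open>The means to be constructed satisfy \<open>A < B\<close> only with a parameter
  \<open>c > 1\<close>, which reaches only pairs with \<open>X < Y\<close>; this notion records what
  is obtained directly.\<close>

definition strictly_operator_monotone :: "(real \<Rightarrow> real) \<Rightarrow> bool" where
  "strictly_operator_monotone g \<longleftrightarrow>
     (\<forall>n X Y. pd_mat n X \<and> pd_mat n Y \<and> loewner_less n X Y \<longrightarrow>
        loewner_le n (mat_fun g X) (mat_fun g Y))"

lemma loewner_less_imp_le: "loewner_less n X Y \<Longrightarrow> loewner_le n X Y"
proof -
  assume a: "loewner_less n X Y"
  have "0 \<le> Re (((Y - X) *\<^sub>v v) \<bullet>c v)" if v: "v \<in> carrier_vec n" for v
  proof (cases "v = 0\<^sub>v n")
    case True
    then show ?thesis using a by (auto simp: loewner_less_def mult_mat_vec_carrier[of _ n n] minus_carrier_mat)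
  next
    case False
    then show ?thesis using a v by (auto simp: loewner_less_def pd_mat_def less_imp_le)
  qed
  then show ?thesis using a unfolding loewner_less_def loewner_le_def psd_mat_def pd_mat_def by blast
qed

lemma operator_monotone_imp_strictly:
  "operator_monotone g \<Longrightarrow> strictly_operator_monotone g"
  unfolding operator_monotone_def strictly_operator_monotone_def
  using loewner_less_imp_le by blast

lemma mat_fun_cdiag_one:
  "mat_fun h (cdiag n (1\<^sub>m n) d) = cdiag n (1\<^sub>m n) (\<lambda>i. h (d i))"
  by (rule mat_fun_cdiag) auto

text \<open>Matrices of size 1 are positive reals with their usual order.\<close>

lemma strictly_operator_monotone_mono:
  assumes g: "strictly_operator_monotone g" and s: "0 < s" "s \<le> t"
  shows "g s \<le> g t"
proof (cases "s = t")
  case False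
  let ?c = "\<lambda>t. cdiag 1 (1\<^sub>m 1) (\<lambda>_. t :: real)"
  have "pd_mat 1 (?c s)" "pd_mat 1 (?c t)" "loewner_less 1 (?c s) (?c t)"
    using s False by (auto intro!: pd_cdiag loewner_less_cdiag)
  then have "loewner_le 1 (mat_fun g (?c s)) (mat_fun g (?c t))"
    using g unfolding strictly_operator_monotone_def by blast
  then show ?thesis unfolding mat_fun_cdiag_one
    using loewner_le_cdiagD[of 1 "1\<^sub>m 1" "\<lambda>_. g s" "\<lambda>_. g t" 0] by simp
qed simp

text \<open>Rotating $\mathrm{diag}(a,b)$ gives a $2\times 2$ matrix with upper left entry $la+(1-l)b$; it lies
  below a diagonal matrix with upper left entry $la+(1-l)b+e$ and a large lower right entry, so
  comparing the upper left entries after applying \<open>g\<close> gives the claim.\<close>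

lemma strictly_operator_monotone_almost_concave:
  assumes g: "strictly_operator_monotone g"
    and a: "0 < a" and b: "0 < b" and l: "0 \<le> l" "l \<le> 1" and e: "0 < e"
  shows "l * g a + (1 - l) * g b \<le> g (l * a + (1 - l) * b + e)"
proof -
  define p where "p = sqrt l"
  define q where "q = sqrt (1 - l)"
  have p2: "p\<^sup>2 = l" and q2: "q\<^sup>2 = 1 - l" unfolding p_def q_def using l by auto
  have pq: "p\<^sup>2 + q\<^sup>2 = 1" using p2 q2 by simp
  define U where "U = Matrix.mat 2 2 (\<lambda>(i, j). complex_of_real
    (if i = 0 then (if j = 0 then p else - q) else (if j = 0 then q else p)))"
  have U: "U \<in> carrier_mat 2 2" unfolding U_def by simp
  have less2: "i < 2 \<longleftrightarrow> i = 0 \<or> i = Suc 0" for i :: nat by auto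
  have sum2: "(\<Sum>k<2. h k) = h 0 + h (Suc 0)" for h :: "nat \<Rightarrow> 'b :: comm_monoid_add"
    by (simp add: numeral_2_eq_2)
  have pqc: "complex_of_real p * complex_of_real p + complex_of_real q * complex_of_real q = 1"
    using pq by (simp add: power2_eq_square flip: of_real_mult of_real_add)
  have UU: "mat_adjoint U * U = 1\<^sub>m 2"
  proof (rule eq_matI)
    fix i j assume "i < dim_row (1\<^sub>m 2 :: complex mat)" "j < dim_col (1\<^sub>m 2 :: complex mat)"
    then have ij: "i < 2" "j < 2" by auto
    then have "(mat_adjoint U * U) $$ (i, j) = (\<Sum>k<2. cnj (U $$ (k, i)) * U $$ (k, j))"
      using U by (subst mat_mult_index[where n=2]) auto
    also have "\<dots> = 1\<^sub>m 2 $$ (i, j)"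
      using ij pqc unfolding sum2 U_def less2 by (auto simp: add.commute)
    finally show "(mat_adjoint U * U) $$ (i, j) = 1\<^sub>m 2 $$ (i, j)" .
  qed (use U in auto)
  note Ui = invertible_square_unitary[OF U UU]
  define d where "d i = (if i = 0 then a else b)" for i :: nat
  \<comment> \<open>The two entries are the coefficients on the right-hand side of
    \<open>rotation_form_less\<close>.\<close>
  define r where "r i = (if i = 0 then l * a + (1 - l) * b + e else a + b + (a + b)\<^sup>2 / e + 1)" for i :: nat
  let ?X = "cdiag 2 U d" and ?Y = "cdiag 2 (1\<^sub>m 2) r"
  have adjU: "vec_index (mat_adjoint U *\<^sub>v v) 0 = of_real p * vec_index v 0 + of_real q * vec_index v (Suc 0)"
    "vec_index (mat_adjoint U *\<^sub>v v) (Suc 0) = of_real p * vec_index v (Suc 0) - of_real q * vec_index v 0"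
    if "v \<in> carrier_vec 2" for v
    using that U unfolding U_def by (auto simp: scalar_prod_def numeral_2_eq_2)
  have formU: "Re ((cdiag 2 U h *\<^sub>v v) \<bullet>c v) =
      h 0 * (cmod (of_real p * vec_index v 0 + of_real q * vec_index v (Suc 0)))\<^sup>2 +
      h (Suc 0) * (cmod (of_real p * vec_index v (Suc 0) - of_real q * vec_index v 0))\<^sup>2"
    if "v \<in> carrier_vec 2" for v h
    unfolding cdiag_form[OF U that] sum2 adjU[OF that] ..
  have form1: "Re ((cdiag 2 (1\<^sub>m 2) h *\<^sub>v v) \<bullet>c v) =
      h 0 * (cmod (vec_index v 0))\<^sup>2 + h (Suc 0) * (cmod (vec_index v (Suc 0)))\<^sup>2"
    if "v \<in> carrier_vec 2" for v h
    using that by (simp add: cdiag_form[OF one_carrier_mat that] sum2)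
  have "loewner_less 2 ?X ?Y"
    unfolding loewner_less_iff[OF cdiag_hermitian[OF U] cdiag_hermitian[OF one_carrier_mat]]
  proof (intro ballI impI)
    fix v :: "complex vec" assume v: "v \<in> carrier_vec 2" "v \<noteq> 0\<^sub>v 2"
    \<comment> \<open>All matrices here are real, so the form at a complex vector is the sum of the
      forms at its real and imaginary parts. Each part satisfies the weak inequality, and a nonzero
      part the strict one.\<close>
    define x1 x2 y1 y2 where "x1 = Re (vec_index v 0)" "x2 = Im (vec_index v 0)"
      "y1 = Re (vec_index v (Suc 0))" "y2 = Im (vec_index v (Suc 0))"
    note xy = this
    have nz: "x1 \<noteq> 0 \<or> y1 \<noteq> 0 \<or> x2 \<noteq> 0 \<or> y2 \<noteq> 0"
    proof (rule ccontr)
      assume "\<not> ?thesis"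
      then have "v = 0\<^sub>v 2" using v(1) by (intro eq_vecI) (auto simp: xy less2 complex_eq_iff)
      then show False using v by simp
    qed
    let ?L = "\<lambda>x y. a * (p * x + q * y)\<^sup>2 + b * (p * y - q * x)\<^sup>2"
    let ?R = "\<lambda>x y. r 0 * x\<^sup>2 + r (Suc 0) * y\<^sup>2"
    have lt: "?L x y < ?R x y" if "x \<noteq> 0 \<or> y \<noteq> 0" for x y
      using rotation_form_less[OF pq a b e that] unfolding r_def p2 q2 by simp
    have le: "?L x y \<le> ?R x y" for x y
      using lt[of x y] by (cases "x = 0 \<and> y = 0") auto
    have "?L x1 y1 + ?L x2 y2 < ?R x1 y1 + ?R x2 y2"
      using lt[of x1 y1] lt[of x2 y2] le[of x1 y1] le[of x2 y2] nz by (meson add_less_le_mono add_le_less_mono)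
    then show "Re ((?X *\<^sub>v v) \<bullet>c v) < Re ((?Y *\<^sub>v v) \<bullet>c v)"
      unfolding formU[OF v(1)] form1[OF v(1)] cmod_power2
      by (simp add: d_def algebra_simps flip: xy)
  qed
  moreover have "pd_mat 2 ?X" using a b by (intro pd_cdiag[OF Ui]) (auto simp: d_def)
  moreover have "pd_mat 2 ?Y"
    using a b l e by (intro pd_cdiag) (auto simp: r_def intro!: add_nonneg_pos add_nonneg_nonneg)
  ultimately have "loewner_le 2 (mat_fun g ?X) (mat_fun g ?Y)"
    using g unfolding strictly_operator_monotone_def by blast
  then have le: "loewner_le 2 (cdiag 2 U (\<lambda>i. g (d i))) (cdiag 2 (1\<^sub>m 2) (\<lambda>i. g (r i)))"
    unfolding mat_fun_cdiag[OF U UU] mat_fun_cdiag_one .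
  define u where "u = (unit_vec 2 0 :: complex vec)"
  have u: "u \<in> carrier_vec 2" and u01: "vec_index u 0 = 1" "vec_index u (Suc 0) = 0"
    unfolding u_def by auto
  have "Re ((cdiag 2 U (\<lambda>i. g (d i)) *\<^sub>v u) \<bullet>c u) \<le> Re ((cdiag 2 (1\<^sub>m 2) (\<lambda>i. g (r i)) *\<^sub>v u) \<bullet>c u)"
    using le loewner_le_iff[OF cdiag_hermitian[OF U] cdiag_hermitian[OF one_carrier_mat]] u by blast
  then show ?thesis
    unfolding formU[OF u] form1[OF u] u01 using l by (simp add: d_def r_def p_def q_def mult.commute)
qed

text \<open>Near-concavity rules out a jump of the monotone function \<open>g\<close>: a convex
  combination of \<open>t / 2\<close> and \<open>t + d\<close> with small weight \<open>l\<close> on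
  \<open>t / 2\<close> still lies, even after adding \<open>d\<close>, below \<open>t - d\<close>.
  This bounds \<open>g (t + d) - g (t - d)\<close> by \<open>l\<close> times the oscillation
  \<open>K\<close>.\<close>

lemma strictly_operator_monotone_isCont:
  assumes g: "strictly_operator_monotone g" and t: "0 < t"
  shows "isCont g t"
proof -
  note mono = strictly_operator_monotone_mono[OF g]
  have "\<exists>d>0. \<forall>s. \<bar>s - t\<bar> < d \<longrightarrow> \<bar>g s - g t\<bar> < e" if e: "0 < e" for e
  proof -
    define K where "K = g (2 * t) - g (t / 2)"
    have K: "K \<ge> 0" unfolding K_def using mono[of "t / 2" "2 * t"] t by simp
    define l where "l = min (1 / 2) (e / (2 * (K + 1)))"
    have l: "0 < l" unfolding l_def using e K by auto
    have l2: "l \<le> 1 / 2" unfolding l_def by (rule min.cobounded1)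
    have "l * K \<le> e / (2 * (K + 1)) * K" unfolding l_def using K by (intro mult_right_mono) auto
    also have "\<dots> < e" using e K by (simp add: field_simps add_nonneg_pos)
    finally have lK: "l * K < e" .
    \<comment> \<open>Then \<open>l * t / 2 = 4 * d\<close>, so the shifted combination is at most
      \<open>t - 2 * d\<close>.\<close>
    define d where "d = l * t / 8"
    have d: "0 < d" "d \<le> t / 16" unfolding d_def using l l2 t by auto
    have "l * g (t / 2) + (1 - l) * g (t + d) \<le> g (l * (t / 2) + (1 - l) * (t + d) + d)"
      using l l2 t d by (intro strictly_operator_monotone_almost_concave[OF g]) auto
    also have "\<dots> \<le> g (t - d)"
    proof (rule mono)
      show "0 < l * (t / 2) + (1 - l) * (t + d) + d"
        using l l2 t d by (intro add_pos_pos mult_pos_pos) auto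
      have "l * (t / 2) + (1 - l) * (t + d) + d = t - l * t / 2 + 2 * d - l * d"
        by (simp add: field_simps)
      moreover have "l * t = 8 * d" unfolding d_def by simp
      moreover have "0 \<le> l * d" using l d by simp
      ultimately show "l * (t / 2) + (1 - l) * (t + d) + d \<le> t - d"
        using d by linarith
    qed
    finally have "g (t + d) - g (t - d) \<le> l * (g (t + d) - g (t / 2))" by (simp add: algebra_simps)
    also have "\<dots> \<le> l * K" unfolding K_def using mono[of "t + d" "2 * t"] l t d by (intro mult_left_mono) auto
    finally have *: "g (t + d) - g (t - d) < e" using lK by simp
    have "\<bar>g s - g t\<bar> < e" if s: "\<bar>s - t\<bar> < d" for s
    proof -
      have "0 < t - d" using d t by auto
      then have "g (t - d) \<le> g s" "g s \<le> g (t + d)" "g (t - d) \<le> g t" "g t \<le> g (t + d)"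
        using s d by (auto intro!: mono)
      then show ?thesis using * by linarith
    qed
    then show ?thesis using d by blast
  qed
  then show ?thesis
    unfolding continuous_at_eps_delta dist_real_def by simp
qed

text \<open>Adding \<open>e > 0\<close> to every eigenvalue of \<open>Y\<close> makes the comparison
  with \<open>X\<close> strict without changing the eigenvectors. For a fixed vector the form is
  then a finite sum of values of \<open>g\<close> at \<open>y i + e\<close>, and continuity allows
  \<open>e\<close> to tend to 0.\<close>

lemma strictly_operator_monotone_imp_operator_monotone:
  assumes g: "strictly_operator_monotone g"
  shows "operator_monotone g"
  unfolding operator_monotone_def
proof (intro allI impI, elim conjE)
  fix n X Y assume X: "pd_mat n X" and Y: "pd_mat n Y" and XY: "loewner_le n X Y"
  have Xh: "hermitian_mat n X" and Yh: "hermitian_mat n Y" using X Y unfolding pd_mat_def by auto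
  obtain V y where V: "V \<in> carrier_mat n n" "mat_adjoint V * V = 1\<^sub>m n" and YV: "Y = cdiag n V y"
    using spectral_theorem[OF Yh] by metis
  note Vi = invertible_square_unitary[OF V]
  have y: "0 < y i" if "i < n" for i using pd_cdiagD[OF Vi, of y i] Y YV that by simp
  let ?Y = "\<lambda>e. cdiag n V (\<lambda>i. y i + e)"
  have step: "loewner_le n (mat_fun g X) (cdiag n V (\<lambda>i. g (y i + e)))" if e: "e > 0" for e
  proof -
    have "loewner_less n Y (?Y e)" unfolding YV using e by (intro loewner_less_cdiag[OF Vi]) auto
    then have "loewner_less n X (?Y e)"
      using XY Xh Yh cdiag_hermitian[OF V(1), of "\<lambda>i. y i + e"]
      by (meson loewner_le_iff loewner_less_iff order_le_less_trans)
    moreover have "pd_mat n (?Y e)" using y e by (intro pd_cdiag[OF Vi]) (auto simp: add_pos_pos)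
    ultimately have "loewner_le n (mat_fun g X) (mat_fun g (?Y e))"
      using g X unfolding strictly_operator_monotone_def by blast
    then show ?thesis unfolding mat_fun_cdiag[OF V] .
  qed
  have gXh: "hermitian_mat n (mat_fun g X)" by (rule mat_fun_hermitian[OF Xh])
  have "loewner_le n (mat_fun g X) (cdiag n V (\<lambda>i. g (y i)))"
    unfolding loewner_le_iff[OF gXh cdiag_hermitian[OF V(1)]]
  proof
    fix v :: "complex vec" assume v: "v \<in> carrier_vec n"
    let ?q = "\<lambda>e. Re ((cdiag n V (\<lambda>i. g (y i + e)) *\<^sub>v v) \<bullet>c v)"
    have "((\<lambda>e. g (y i + e)) \<longlongrightarrow> g (y i)) (at_right 0)" if "i < n" for i
    proof -
      have "isCont (\<lambda>e. g (y i + e)) 0"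
        using strictly_operator_monotone_isCont[OF g y[OF that]]
        by (intro isCont_o2[where f = "\<lambda>e. y i + e" and g = g]) simp_all
      then have "((\<lambda>e. g (y i + e)) \<longlongrightarrow> g (y i)) (at 0)" unfolding isCont_def by simp
      then show ?thesis by (rule tendsto_mono[OF at_le[OF subset_UNIV]])
    qed
    then have "(?q \<longlongrightarrow> Re ((cdiag n V (\<lambda>i. g (y i)) *\<^sub>v v) \<bullet>c v)) (at_right 0)"
      unfolding cdiag_form[OF V(1) v] by (intro tendsto_sum tendsto_mult tendsto_const) auto
    moreover have "eventually (\<lambda>e. Re ((mat_fun g X *\<^sub>v v) \<bullet>c v) \<le> ?q e) (at_right 0)"
      using eventually_at_right_less[of 0]
    proof eventually_elim
      case (elim e)
      then show ?case
        using step loewner_le_iff[OF gXh cdiag_hermitian[OF V(1)]] v by blast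
    qed
    ultimately show "Re ((mat_fun g X *\<^sub>v v) \<bullet>c v) \<le> Re ((cdiag n V (\<lambda>i. g (y i)) *\<^sub>v v) \<bullet>c v)"
      by (intro tendsto_lowerbound) auto
  qed
  then show "loewner_le n (mat_fun g X) (mat_fun g Y)"
    unfolding YV mat_fun_cdiag[OF V] .
qed

section \<open>Reduction to scalar equations\<close>

text \<open>Geometric means inserted entrywise split a large ratio into smaller ones. Each insertion
  takes the square root of the ratio bound, hence the exponents \<open>2 ^ k\<close>; transitivity
  joins the pieces.\<close>

lemma operator_monotone_if_locally_monotone:
  fixes M :: real
  assumes M: "1 < M"
    and local: "\<And>n T x y. invertible_square n T \<Longrightarrow> (\<And>i. i < n \<Longrightarrow> 0 < x i \<and> x i < y i \<and> y i \<le> M * x i) \<Longrightarrow>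
      loewner_le n (mat_fun g (cdiag n T x)) (mat_fun g (cdiag n T y))"
  shows "operator_monotone g"
proof (rule strictly_operator_monotone_imp_operator_monotone)
  have chain: "loewner_le n (mat_fun g (cdiag n T x)) (mat_fun g (cdiag n T y))"
    if T: "invertible_square n T" and xy: "\<And>i. i < n \<Longrightarrow> 0 < x i \<and> x i < y i \<and> y i \<le> M ^ (2 ^ k) * x i"
    for n T x y and k :: nat
    using xy
  proof (induction k arbitrary: x y)
    case 0
    then show ?case using T by (intro local) auto
  next
    case (Suc k)
    \<comment> \<open>Both ratios \<open>z i / x i\<close> and \<open>y i / z i\<close> equal the
      root of \<open>y i / x i\<close>, which is at most \<open>N\<close>.\<close>
    define z where "z i = sqrt (x i * y i)" for i
    define N where "N = M ^ (2 ^ k)"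
    have N: "N > 0" unfolding N_def using M by simp
    have N2: "M ^ (2 ^ Suc k) = N\<^sup>2"
      unfolding N_def by (simp add: power_mult[symmetric] mult.commute)
    have z: "0 < x i \<and> x i < z i \<and> z i \<le> N * x i" "0 < z i \<and> z i < y i \<and> y i \<le> N * z i" if i: "i < n" for i
    proof -
      have a: "0 < x i" "x i < y i" "y i \<le> N\<^sup>2 * x i" using Suc.prems[OF i] unfolding N2 by auto
      have "(x i)\<^sup>2 < x i * y i" "x i * y i < (y i)\<^sup>2" using a by (simp_all add: power2_eq_square)
      then have "x i < z i" "z i < y i" unfolding z_def using a by (auto intro: real_less_rsqrt real_less_lsqrt)
      moreover have "z i \<le> N * x i"
        unfolding z_def
      proof (rule real_le_lsqrt)
        have "x i * y i \<le> x i * (N\<^sup>2 * x i)" using a by (intro mult_left_mono) auto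
        then show "x i * y i \<le> (N * x i)\<^sup>2" by (simp add: power2_eq_square mult_ac)
      qed (use a N in auto)
      moreover have "y i \<le> N * z i"
      proof (rule power2_le_imp_le)
        have "y i * y i \<le> y i * (N\<^sup>2 * x i)" using a by (intro mult_left_mono) auto
        then show "(y i)\<^sup>2 \<le> (N * z i)\<^sup>2" unfolding z_def using a by (simp add: power_mult_distrib power2_eq_square mult_ac)
      qed (use a N in \<open>auto simp: z_def\<close>)
      ultimately show "0 < x i \<and> x i < z i \<and> z i \<le> N * x i" "0 < z i \<and> z i < y i \<and> y i \<le> N * z i"
        using a by auto
    qed
    have h: "hermitian_mat n (mat_fun g (cdiag n T d))" for d
      using T by (intro mat_fun_hermitian) auto
    show ?case
      by (rule loewner_le_trans[OF h h h Suc.IH Suc.IH]) (use z in \<open>unfold N_def, blast+\<close>)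
  qed
  show "strictly_operator_monotone g"
    unfolding strictly_operator_monotone_def
  proof (intro allI impI, elim conjE)
    fix n X Y assume X: "pd_mat n X" and Y: "pd_mat n Y" and XY: "loewner_less n X Y"
    obtain T y where T: "invertible_square n T" and XT: "X = cdiag n T (\<lambda>i. 1)" and YT: "Y = cdiag n T y"
      using simultaneous_cdiag[OF X] Y unfolding pd_mat_def by metis
    have y: "1 < y i" if "i < n" for i
      using loewner_less_cdiagD[OF T, of "\<lambda>i. 1" y i] XY that unfolding XT YT by simp
    \<comment> \<open>A single \<open>k\<close> must serve all indices; the sum of the
      \<open>y i\<close> dominates each of them, as all are positive.\<close>
    obtain k where k: "(\<Sum>i<n. y i) < M ^ k" using real_arch_pow[OF M] by blast
    have "y i \<le> M ^ (2 ^ k)" if i: "i < n" for i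
    proof -
      have "y i \<le> (\<Sum>i<n. y i)" using i y by (intro member_le_sum) (auto dest!: y)
      also have "\<dots> \<le> M ^ k" using k by simp
      also have "\<dots> \<le> M ^ (2 ^ k)" using M by (intro power_increasing) (auto simp: less_imp_le less_exp)
      finally show ?thesis .
    qed
    then show "loewner_le n (mat_fun g X) (mat_fun g Y)"
      unfolding XT YT using y by (intro chain[OF T, of _ _ k]) auto
  qed
qed

section \<open>Self-adjointness and the range of the scalar quotient\<close>

lemma mat_inv_eqI:
  assumes A: "A \<in> carrier_mat n n" and B: "B \<in> carrier_mat n n" and AB: "A * B = 1\<^sub>m n"
  shows "mat_inv A = B"
proof -
  have BA: "B * A = 1\<^sub>m n" by (rule mat_mult_left_right_inverse[OF A B AB])
  \<comment> \<open>\<open>mat_inverse\<close> returns an option; being a unit of the matrix ring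
    excludes \<open>None\<close>.\<close>
  have "A \<in> Units (ring_mat TYPE(complex) n ())"
    using A B AB BA unfolding Units_def by (auto simp: ring_mat_simps)
  then have "mat_inverse A \<noteq> None" using mat_inverse(1)[OF A, of "()"] by auto
  then obtain C where C: "mat_inverse A = Some C" by auto
  then have "A * C = 1\<^sub>m n" "C \<in> carrier_mat n n"
    using mat_inverse(2)[OF A] by auto
  then have "C = B" using mult_cancel_inverse[OF B A BA] B by (metis right_mult_one_mat)
  then show ?thesis using C by simp
qed

lemma mat_inv_cdiag_one:
  assumes "t \<noteq> 0"
  shows "mat_inv (cdiag n (1\<^sub>m n) (\<lambda>_. t)) = cdiag n (1\<^sub>m n) (\<lambda>_. 1 / t)"
proof (rule mat_inv_eqI)
  show "cdiag n (1\<^sub>m n) (\<lambda>_. t) * cdiag n (1\<^sub>m n) (\<lambda>_. 1 / t) = 1\<^sub>m n"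
    using assms unfolding cdiag_def
    by (simp add: right_mult_one_mat[of _ n n] left_mult_one_mat[of _ n n])
qed auto

text \<open>In size 1 the mean of 1 and \<open>t\<close> is \<open>f t\<close>, so self-adjointness
  of the mean at this pair is the functional equation.\<close>

lemma self_adjoint_mean_inverse:
  assumes \<sigma>: "operator_mean \<sigma> f" "self_adjoint_mean \<sigma>" and t: "0 < t"
  shows "f (1 / t) = 1 / f t"
proof -
  let ?c = "\<lambda>t. cdiag 1 (1\<^sub>m 1) (\<lambda>_. t :: real)"
  have pd: "pd_mat 1 (?c s)" if "s > 0" for s using that by (auto intro: pd_cdiag)
  have mean: "\<sigma> (?c 1) (?c s) = ?c (f s)" if "s > 0" for s
    using \<sigma>(1) pd[of 1] pd[OF that] unfolding operator_mean_def
    by (simp add: op_mean_cdiag)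
  have "?c (1 / f t) = mat_inv (\<sigma> (?c 1) (?c t))"
    using \<sigma>(1) t unfolding mean[OF t] operator_mean_def by (subst mat_inv_cdiag_one) (auto simp: less_imp_neq[symmetric])
  also have "\<dots> = \<sigma> (mat_inv (?c 1)) (mat_inv (?c t))"
    using \<sigma>(2) pd[of 1] pd[OF t] unfolding self_adjoint_mean_def by auto
  also have "\<dots> = ?c (f (1 / t))"
    using t mean[of "1 / t"] by (simp add: mat_inv_cdiag_one)
  finally have "?c (1 / f t) $$ (0, 0) = ?c (f (1 / t)) $$ (0, 0)" by simp
  then show ?thesis by (simp add: cdiag_index[of _ 1] flip: of_real_divide)
qed

text \<open>\<open>hansen_rep\<close> sees a function only on positive arguments. Agreement there
  makes the two predicates equal, so \<open>SOME\<close> picks the same density for both and the set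
  where the densities differ is empty.\<close>

lemma sa_less_sqrt_differs:
  assumes "sa_less sqrt f"
  obtains t where "0 < t" "f t \<noteq> sqrt t"
proof -
  have False if "\<And>t. 0 < t \<Longrightarrow> f t = sqrt t"
  proof -
    have "hansen_rep f = hansen_rep sqrt"
      using that unfolding hansen_rep_def by (intro ext) auto
    then have "hansen_density f = hansen_density sqrt" unfolding hansen_density_def by simp
    then show False using assms unfolding sa_less_def by simp
  qed
  then show ?thesis using that by blast
qed

text \<open>The quotient \<open>\<phi>\<close> is continuous, equals 1 at 1 and exceeds 1 somewhere;
  that larger value serves as \<open>M\<close>, and the intermediate value theorem fills the
  gap.\<close>

lemma sa_less_sqrt_range:
  assumes less: "sa_less sqrt f" and pos: "\<And>t. 0 < t \<Longrightarrow> 0 < f t" and one: "f 1 = 1"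
    and inv: "\<And>t. 0 < t \<Longrightarrow> f (1 / t) = 1 / f t"
  obtains M where "1 < M" "\<And>y. 1 < y \<Longrightarrow> y \<le> M \<Longrightarrow> \<exists>c>1. f (c\<^sup>2) / c = y"
proof -
  define \<phi> where "\<phi> t = f t / sqrt t" for t
  have \<phi>: "strictly_operator_monotone \<phi>"
    using less operator_monotone_imp_strictly unfolding sa_less_def sa_le_def \<phi>_def[abs_def] by blast
  have \<phi>1: "\<phi> 1 = 1" unfolding \<phi>_def using one by simp
  have \<phi>pos: "0 < \<phi> t" if "0 < t" for t unfolding \<phi>_def using pos that by simp
  have \<phi>inv: "\<phi> (1 / t) = 1 / \<phi> t" if "0 < t" for t
    unfolding \<phi>_def using inv[OF that] by (simp add: real_sqrt_divide)
  obtain s where s: "0 < s" "f s \<noteq> sqrt s" using sa_less_sqrt_differs[OF less] .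
  then have "\<phi> s \<noteq> 1" unfolding \<phi>_def by simp
  \<comment> \<open>As \<open>\<phi>\<close> turns reciprocals into reciprocals, it exceeds 1 at
    \<open>s\<close> or at \<open>1 / s\<close>.\<close>
  then obtain t where t: "0 < t" "1 < \<phi> t"
  proof (cases "\<phi> s < 1")
    case True
    then have "1 < \<phi> (1 / s)" unfolding \<phi>inv[OF s(1)] using \<phi>pos[OF s(1)] by simp
    then show ?thesis using s(1) by (intro that[of "1 / s"]) simp_all
  qed (use that s \<open>\<phi> s \<noteq> 1\<close> in auto)
  have t1: "1 < t"
    using strictly_operator_monotone_mono[OF \<phi> t(1), of 1] t \<phi>1 by linarith
  show ?thesis
  proof (rule that[OF t(2)])
    fix y assume y: "1 < y" "y \<le> \<phi> t"
    have "continuous_on {1..t} \<phi>"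
      by (intro continuous_at_imp_continuous_on ballI strictly_operator_monotone_isCont[OF \<phi>]) auto
    then obtain s where s: "1 \<le> s" "\<phi> s = y" using IVT'[of \<phi> 1 y t] y t1 \<phi>1 by auto
    then have "1 < s" using \<phi>1 y by (cases "s = 1") auto
    \<comment> \<open>For \<open>c = sqrt s\<close> the quotient \<open>f (c\<^sup>2) / c\<close> is
      \<open>\<phi> s\<close>.\<close>
    then show "\<exists>c>1. f (c\<^sup>2) / c = y"
      using s unfolding \<phi>_def by (intro exI[of _ "sqrt s"]) auto
  qed
qed

text \<open>By \<open>op_mean_cdiag\<close>, scalar solutions \<open>a i\<close>, \<open>b i\<close>
  assemble into matrices with the same \<open>T\<close> whose two means are the prescribed ones.
  Keeping \<open>m1\<close> and \<open>m2\<close> general serves both parts: (a) uses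
  \<open>sqrt\<close> and \<open>f\<close>, (b) uses them in the opposite order.\<close>

lemma operator_monotone_if_means_attain:
  fixes M :: real and m1 m2 :: "real \<Rightarrow> real"
  assumes M: "1 < M"
    and attain: "\<And>x y. 0 < x \<Longrightarrow> x < y \<Longrightarrow> y \<le> M * x \<Longrightarrow>
      \<exists>a b. 0 < a \<and> a < b \<and> a * m1 (b / a) = x \<and> a * m2 (b / a) = y"
    and le: "\<And>n A B. pd_mat n A \<Longrightarrow> pd_mat n B \<Longrightarrow> loewner_less n A B \<Longrightarrow>
      loewner_le n (mat_fun g (op_mean m1 A B)) (mat_fun g (op_mean m2 A B))"
  shows "operator_monotone g"
proof (rule operator_monotone_if_locally_monotone[OF M])
  fix n T and x y :: "nat \<Rightarrow> real"
  assume T: "invertible_square n T" and xy: "\<And>i. i < n \<Longrightarrow> 0 < x i \<and> x i < y i \<and> y i \<le> M * x i"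
  have "\<forall>i. \<exists>a b. i < n \<longrightarrow> 0 < a \<and> a < b \<and> a * m1 (b / a) = x i \<and> a * m2 (b / a) = y i"
    using attain xy by meson
  then obtain a b where ab: "\<And>i. i < n \<Longrightarrow> 0 < a i \<and> a i < b i \<and> a i * m1 (b i / a i) = x i \<and> a i * m2 (b i / a i) = y i"
    by metis
  let ?A = "cdiag n T a" and ?B = "cdiag n T b"
  have "op_mean m1 ?A ?B = cdiag n T x" "op_mean m2 ?A ?B = cdiag n T y"
    using ab by (subst op_mean_cdiag[OF T]; auto intro: cdiag_cong)+
  moreover have "pd_mat n ?A" "pd_mat n ?B" "loewner_less n ?A ?B"
    using ab T by (auto intro!: pd_cdiag loewner_less_cdiag dest: ab intro: less_trans)
  ultimately show "loewner_le n (mat_fun g (cdiag n T x)) (mat_fun g (cdiag n T y))"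
    using le[of n ?A ?B] by simp
qed

theorem theorem12:
  fixes \<sigma> :: "complex mat \<Rightarrow> complex mat \<Rightarrow> complex mat"
    and f g :: "real \<Rightarrow> real"
  assumes "operator_mean \<sigma> f" and "self_adjoint_mean \<sigma>"
  shows "(sa_less sqrt f \<and>
      (\<forall>n A B. pd_mat n A \<and> pd_mat n B \<and> loewner_less n A B \<longrightarrow>
         loewner_le n (mat_fun g (geometric_mean A B)) (mat_fun g (\<sigma> A B)))
      \<longrightarrow> operator_monotone g) \<and>
    (sa_less sqrt (\<lambda>t. t / f t) \<and>
      (\<forall>n A B. pd_mat n A \<and> pd_mat n B \<and> loewner_less n A B \<longrightarrow>
         loewner_le n (mat_fun g (\<sigma> A B)) (mat_fun g (geometric_mean A B)))
      \<longrightarrow> operator_monotone g)"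
proof -
  have pos: "0 < f t" if "0 < t" for t
    using assms(1) that unfolding operator_mean_def by blast
  have \<sigma>: "\<sigma> A B = op_mean f A B" if "pd_mat n A" "pd_mat n B" for n A B
    using assms(1) that unfolding operator_mean_def by blast
  have one: "f 1 = 1" using assms(1) unfolding operator_mean_def by blast
  note inv = self_adjoint_mean_inverse[OF assms]
  \<comment> \<open>The pair \<open>x / c\<close>, \<open>x * c\<close> has geometric mean
    \<open>x\<close> for every \<open>c\<close>, which leaves \<open>c\<close> free to adjust the
    other mean.\<close>
  have root: "x / c * sqrt (x * c / (x / c)) = x" "x * c / (x / c) = c\<^sup>2" "0 < x / c" "x / c < x * c"
    if "0 < x" "1 < c" for x c :: real
  proof -
    have "1 < c * c" using that by (meson less_1_mult)
    then show "x / c < x * c" using that by (simp add: field_simps)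
  qed (use that in \<open>auto simp: real_sqrt_mult real_sqrt_divide field_simps power2_eq_square\<close>)
  show ?thesis
  proof (intro conjI impI; elim conjE)
    assume less: "sa_less sqrt f" and le: "\<forall>n A B. pd_mat n A \<and> pd_mat n B \<and> loewner_less n A B \<longrightarrow>
         loewner_le n (mat_fun g (geometric_mean A B)) (mat_fun g (\<sigma> A B))"
    obtain M where M: "1 < M" "\<And>y. 1 < y \<Longrightarrow> y \<le> M \<Longrightarrow> \<exists>c>1. f (c\<^sup>2) / c = y"
      using sa_less_sqrt_range[OF less pos one inv] by blast
    show "operator_monotone g"
    proof (rule operator_monotone_if_means_attain[OF M(1)])
      fix x y :: real assume xy: "0 < x" "x < y" "y \<le> M * x"
      \<comment> \<open>By homogeneity only the ratio \<open>y / x\<close> matters, and it lies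
        above 1 and at most at \<open>M\<close>.\<close>
      then obtain c where c: "1 < c" "f (c\<^sup>2) / c = y / x"
        using M(2)[of "y / x"] by (auto simp: field_simps)
      have "x / c * f (c\<^sup>2) = y" using c xy by (simp add: field_simps)
      then show "\<exists>a b. 0 < a \<and> a < b \<and> a * sqrt (b / a) = x \<and> a * f (b / a) = y"
        using root[OF xy(1) c(1)] by (intro exI[of _ "x / c"] exI[of _ "x * c"]) simp
    qed (use le \<sigma> in metis)
  next
    assume less: "sa_less sqrt (\<lambda>t. t / f t)" and le: "\<forall>n A B. pd_mat n A \<and> pd_mat n B \<and> loewner_less n A B \<longrightarrow>
         loewner_le n (mat_fun g (\<sigma> A B)) (mat_fun g (geometric_mean A B))"
    \<comment> \<open>The function \<open>t / f t\<close> inherits from \<open>f\<close> positivity,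
      the value 1 at 1 and the behaviour under inversion.\<close>
    obtain M where M: "1 < M" "\<And>y. 1 < y \<Longrightarrow> y \<le> M \<Longrightarrow> \<exists>c>1. c\<^sup>2 / f (c\<^sup>2) / c = y"
    proof (rule sa_less_sqrt_range[OF less])
      show "1 / t / f (1 / t) = 1 / (t / f t)" if "0 < t" for t
        using inv[OF that] that pos[OF that] by simp
    qed (use pos one in auto)
    show "operator_monotone g"
    proof (rule operator_monotone_if_means_attain[OF M(1)])
      fix x y :: real assume xy: "0 < x" "x < y" "y \<le> M * x"
      then obtain c where c: "1 < c" "c\<^sup>2 / f (c\<^sup>2) / c = y / x"
        using M(2)[of "y / x"] by (auto simp: field_simps)
      have "0 < f (c\<^sup>2)" using c by (intro pos) auto
      then have "y / c * f (c\<^sup>2) = x" using c xy by (simp add: field_simps power2_eq_square)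
      \<comment> \<open>Here the geometric mean has to be the larger value \<open>y\<close>, so the
        pair is centred at \<open>y\<close>; the choice of \<open>c\<close> lowers the other mean to
        \<open>x\<close>.\<close>
      then show "\<exists>a b. 0 < a \<and> a < b \<and> a * f (b / a) = x \<and> a * sqrt (b / a) = y"
        using root[of y c] xy c by (intro exI[of _ "y / c"] exI[of _ "y * c"]) simp
    qed (use le \<sigma> in metis)
  qed
qed

end
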